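(* Let $f_1(C,X),\dots,f_n(C,X)\in\mathbb{Z}[C,X]$, where $C=(C_1,\dots,C_M)$ and $X=(X_1,\dots,X_N)$ are tuples of distinct indeterminates. There exists a finite family $\{\varphi^{(\lambda)}(C)\}_{\lambda\in\Lambda}$ of quantifier-free $\mathcal{L}_{\gcd}$-formulas and for each $\lambda\in\Lambda$ finitely many $n$-by-$1$ column vectors $$y^{(\lambda,1)}(C,X),\dots,y^{(\lambda,K)}(C,X)\qquad(K\in\mathbb{N})$$ whose entries are $\mathcal{L}_{\gcd}$-terms, polynomial in $X$, such that for all $c\in\mathbb{Z}^M$ we have $\mathbb{Z}\models\bigvee_{\lambda\in\Lambda}\varphi^{(\lambda)}(c)$, and if $\lambda\in\Lambda$ is such that $\mathbb{Z}\models\varphi^{(\lambda)}(c)$, then $$y^{(\lambda,1)}(c,X),\dots,y^{(\lambda,K)}(c,X)\in\mathbb{Z}[X]^n$$ generate the $\mathbb{Z}[X]$-module of solutions in $\mathbb{Z}[X]$ to the homogeneous equation $$f_1(c,X)y_1+\cdots+f_n(c,X)y_n=0.$$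
   Context: $\mathcal{L}_{\gcd}=\{0,1,+,-,\cdot,(\ :\ )\}$ is the language of rings augmented by a binary function symbol $(\ :\ )$. The ring $\mathbb{Z}$ is an $\mathcal{L}_{\gcd}$-structure with the usual ring operations and, for $a,b\in\mathbb{Z}$ not both zero, $(a:b):=a/\gcd(a,b)$, where $\gcd(a,b)$ is the positive generator of the ideal $(a,b)$, and $(0:0):=1$. An $\mathcal{L}_{\gcd}$-term $\tau(C,X)$ is called polynomial in $X$ if $\tau(C,X)=f(\tau^*(C),X)$ for some polynomial $f\in\mathbb{Z}[V,X]$, where $V=(V_1,\dots,V_L)$ is a tuple of new variables and $\tau^*(C)$ is an $L$-tuple of $\mathcal{L}_{\gcd}$-terms in the variables $C$ only (so the function symbol $(\ :\ )$ is applied only to subterms not involving the $X$-variables). For $c\in\mathbb{Z}^M$, such a term yields the polynomial $\tau(c,X)=f(\tau^*(c),X)\in\mathbb{Z}[X]$. The number $K$ may depend on $\lambda$. *)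

theory Defs
  imports "HOL-Library.Poly_Mapping" "HOL-Library.FuncSet"
begin

type_synonym 'v int_mpoly = "('v \<Rightarrow>\<^sub>0 nat) \<Rightarrow>\<^sub>0 int"

definition mvar :: "'v \<Rightarrow> 'v int_mpoly" where
  "mvar v = Poly_Mapping.single (Poly_Mapping.single v 1) 1"

definition mvars :: "'v int_mpoly \<Rightarrow> 'v set" where
  "mvars p = (\<Union>m\<in>Poly_Mapping.keys p. Poly_Mapping.keys m)"

text \<open>The polynomial ring in the indeterminates from \<open>V\<close>, as a subring of the ring of all
  integer polynomials with indeterminates from the type \<open>'v\<close>.\<close>

definition mpolys :: "'v set \<Rightarrow> 'v int_mpoly set" where
  "mpolys V = {p. mvars p \<subseteq> V}"

definition mono_eval :: "('v \<Rightarrow> 'a::comm_ring_1) \<Rightarrow> ('v \<Rightarrow>\<^sub>0 nat) \<Rightarrow> 'a" where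
  "mono_eval s m = (\<Prod>v\<in>Poly_Mapping.keys m. s v ^ Poly_Mapping.lookup m v)"

definition mpoly_eval :: "('v \<Rightarrow> 'a::comm_ring_1) \<Rightarrow> 'v int_mpoly \<Rightarrow> 'a" where
  "mpoly_eval s p = (\<Sum>m\<in>Poly_Mapping.keys p. of_int (Poly_Mapping.lookup p m) * mono_eval s m)"

text \<open>In polynomials and terms in \<open>(C, X)\<close>, the indeterminates \<open>C\<^sub>1, C\<^sub>2, \<dots>\<close> are
  \<open>Inl 0, Inl 1, \<dots>\<close> and \<open>X\<^sub>1, X\<^sub>2, \<dots>\<close> are \<open>Inr 0, Inr 1, \<dots>\<close>.\<close>

definition CX_vars :: "nat \<Rightarrow> nat \<Rightarrow> (nat + nat) set" where
  "CX_vars M N = {..<M} <+> {..<N}"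

text \<open>The substitution \<open>(C, X) \<mapsto> (c, X)\<close>; integers are embedded as constant polynomials.\<close>

definition subst_C :: "(nat \<Rightarrow> int) \<Rightarrow> nat + nat \<Rightarrow> nat int_mpoly" where
  "subst_C c = case_sum (\<lambda>i. of_int (c i)) mvar"

definition mpoly_at :: "(nat \<Rightarrow> int) \<Rightarrow> (nat + nat) int_mpoly \<Rightarrow> nat int_mpoly" where
  "mpoly_at c p = mpoly_eval (subst_C c) p"

datatype (gvars: 'v) gcd_term =
    GVar 'v
  | GZero
  | GOne
  | GAdd "'v gcd_term" "'v gcd_term"
  | GSub "'v gcd_term" "'v gcd_term"
  | GMul "'v gcd_term" "'v gcd_term"
  | GColon "'v gcd_term" "'v gcd_term"

datatype (qvars: 'v) qf_formula =
    QEq "'v gcd_term" "'v gcd_term"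
  | QNot "'v qf_formula"
  | QAnd "'v qf_formula" "'v qf_formula"
  | QOr "'v qf_formula" "'v qf_formula"

text \<open>Value of a term in a commutative ring in which \<open>( : )\<close> is interpreted by \<open>d\<close>.\<close>

primrec gcd_eval :: "('a \<Rightarrow> 'a \<Rightarrow> 'a) \<Rightarrow> ('v \<Rightarrow> 'a::comm_ring_1) \<Rightarrow> 'v gcd_term \<Rightarrow> 'a" where
  "gcd_eval d s (GVar v) = s v"
| "gcd_eval d s GZero = 0"
| "gcd_eval d s GOne = 1"
| "gcd_eval d s (GAdd t u) = gcd_eval d s t + gcd_eval d s u"
| "gcd_eval d s (GSub t u) = gcd_eval d s t - gcd_eval d s u"
| "gcd_eval d s (GMul t u) = gcd_eval d s t * gcd_eval d s u"
| "gcd_eval d s (GColon t u) = d (gcd_eval d s t) (gcd_eval d s u)"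

definition int_colon :: "int \<Rightarrow> int \<Rightarrow> int" where
  "int_colon a b = (if a = 0 \<and> b = 0 then 1 else a div gcd a b)"

abbreviation int_value :: "('v \<Rightarrow> int) \<Rightarrow> 'v gcd_term \<Rightarrow> int" where
  "int_value \<equiv> gcd_eval int_colon"

primrec int_sat :: "('v \<Rightarrow> int) \<Rightarrow> 'v qf_formula \<Rightarrow> bool" where
  "int_sat s (QEq t u) \<longleftrightarrow> int_value s t = int_value s u"
| "int_sat s (QNot \<phi>) \<longleftrightarrow> \<not> int_sat s \<phi>"
| "int_sat s (QAnd \<phi> \<psi>) \<longleftrightarrow> int_sat s \<phi> \<and> int_sat s \<psi>"
| "int_sat s (QOr \<phi> \<psi>) \<longleftrightarrow> int_sat s \<phi> \<or> int_sat s \<psi>"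

primrec term_subst :: "('v \<Rightarrow> 'w gcd_term) \<Rightarrow> 'v gcd_term \<Rightarrow> 'w gcd_term" where
  "term_subst r (GVar v) = r v"
| "term_subst r GZero = GZero"
| "term_subst r GOne = GOne"
| "term_subst r (GAdd t u) = GAdd (term_subst r t) (term_subst r u)"
| "term_subst r (GSub t u) = GSub (term_subst r t) (term_subst r u)"
| "term_subst r (GMul t u) = GMul (term_subst r t) (term_subst r u)"
| "term_subst r (GColon t u) = GColon (term_subst r t) (term_subst r u)"

primrec ring_term :: "'v gcd_term \<Rightarrow> bool" where
  "ring_term (GVar v) \<longleftrightarrow> True"
| "ring_term GZero \<longleftrightarrow> True"
| "ring_term GOne \<longleftrightarrow> True"
| "ring_term (GAdd t u) \<longleftrightarrow> ring_term t \<and> ring_term u"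
| "ring_term (GSub t u) \<longleftrightarrow> ring_term t \<and> ring_term u"
| "ring_term (GMul t u) \<longleftrightarrow> ring_term t \<and> ring_term u"
| "ring_term (GColon t u) \<longleftrightarrow> False"

text \<open>The polynomial denoted by a ring term (the interpretation of \<open>( : )\<close> is irrelevant).\<close>

definition ring_term_poly :: "'v gcd_term \<Rightarrow> 'v int_mpoly" where
  "ring_term_poly t = gcd_eval (\<lambda>_ _. 0) mvar t"

text \<open>\<open>\<tau>(C, X) = f(\<tau>\<^sup>*(C), X)\<close> as terms, the polynomial \<open>f(V, X)\<close> being written as a ring term;
  here \<open>V\<^sub>1, \<dots>, V\<^sub>L\<close> are \<open>Inl 0, \<dots>, Inl (L - 1)\<close>, and \<open>ts\<close> is the tuple \<open>\<tau>\<^sup>*\<close>, whose members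
  have no variables besides \<open>C\<^sub>1, \<dots>, C\<^sub>M\<close>.\<close>

definition plug_in :: "(nat \<Rightarrow> nat gcd_term) \<Rightarrow> (nat + nat) gcd_term \<Rightarrow> (nat + nat) gcd_term" where
  "plug_in ts f = term_subst (case_sum (\<lambda>l. map_gcd_term Inl (ts l)) (\<lambda>j. GVar (Inr j))) f"

definition polynomial_in_X :: "nat \<Rightarrow> nat \<Rightarrow> (nat + nat) gcd_term \<Rightarrow> bool" where
  "polynomial_in_X M N \<tau> \<longleftrightarrow>
     (\<exists>L f ts. ring_term f \<and> gvars f \<subseteq> CX_vars L N \<and> (\<forall>l<L. gvars (ts l) \<subseteq> {..<M}) \<and>
        \<tau> = plug_in ts f)"

text \<open>The polynomial \<open>\<tau>(c, X)\<close>. In a term that is polynomial in \<open>X\<close>, the symbol \<open>( : )\<close> is only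
  ever applied to terms whose values at \<open>(c, X)\<close> are constant polynomials, and \<open>const_colon\<close> is the
  integer operation on those; its values on other polynomials are irrelevant. That this yields
  \<open>f(\<tau>\<^sup>*(c), X)\<close> is lemma \<open>term_at_plug_in\<close> below.\<close>

definition const_colon :: "nat int_mpoly \<Rightarrow> nat int_mpoly \<Rightarrow> nat int_mpoly" where
  "const_colon p q = of_int (int_colon (Poly_Mapping.lookup p 0) (Poly_Mapping.lookup q 0))"

definition term_at :: "(nat \<Rightarrow> int) \<Rightarrow> (nat + nat) gcd_term \<Rightarrow> nat int_mpoly" where
  "term_at c \<tau> = gcd_eval const_colon (subst_C c) \<tau>"

lemma mpoly_eval_superset:
  assumes "finite S" "Poly_Mapping.keys p \<subseteq> S"
  shows "mpoly_eval s p = (\<Sum>m\<in>S. of_int (Poly_Mapping.lookup p m) * mono_eval s m)"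
  unfolding mpoly_eval_def
  by (rule sum.mono_neutral_left) (use assms in \<open>auto simp: in_keys_iff\<close>)

lemma mono_eval_superset:
  assumes "finite S" "Poly_Mapping.keys m \<subseteq> S"
  shows "mono_eval s m = (\<Prod>v\<in>S. s v ^ Poly_Mapping.lookup m v)"
  unfolding mono_eval_def
  by (rule prod.mono_neutral_left) (use assms in \<open>auto simp: in_keys_iff\<close>)

lemma mono_eval_add: "mono_eval s (a + b) = mono_eval s a * mono_eval s b"
proof -
  let ?S = "Poly_Mapping.keys a \<union> Poly_Mapping.keys b"
  have "mono_eval s (a + b) = (\<Prod>v\<in>?S. s v ^ Poly_Mapping.lookup (a + b) v)"
    by (rule mono_eval_superset) (auto dest: subsetD[OF keys_add])
  also have "\<dots> = (\<Prod>v\<in>?S. s v ^ Poly_Mapping.lookup a v) * (\<Prod>v\<in>?S. s v ^ Poly_Mapping.lookup b v)"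
    by (simp add: lookup_add power_add prod.distrib)
  also have "\<dots> = mono_eval s a * mono_eval s b"
    by (simp add: mono_eval_superset[of ?S a] mono_eval_superset[of ?S b])
  finally show ?thesis .
qed

lemma mpoly_eval_add: "mpoly_eval s (p + q) = mpoly_eval s p + mpoly_eval s q"
proof -
  let ?S = "Poly_Mapping.keys p \<union> Poly_Mapping.keys q"
  have "mpoly_eval s (p + q) = (\<Sum>m\<in>?S. of_int (Poly_Mapping.lookup (p + q) m) * mono_eval s m)"
    by (rule mpoly_eval_superset) (auto dest: subsetD[OF keys_add])
  also have "\<dots> = mpoly_eval s p + mpoly_eval s q"
    by (simp add: mpoly_eval_superset[of ?S p] mpoly_eval_superset[of ?S q] lookup_add
        ring_distribs sum.distrib)
  finally show ?thesis .
qed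

lemma mpoly_eval_0 [simp]: "mpoly_eval s 0 = 0"
  by (simp add: mpoly_eval_def)

lemma mpoly_eval_single: "mpoly_eval s (Poly_Mapping.single m k) = of_int k * mono_eval s m"
  by (cases "k = 0") (auto simp: mpoly_eval_def)

lemma mpoly_eval_1 [simp]: "mpoly_eval s 1 = 1"
  using mpoly_eval_single[of s 0 1] by (simp add: mono_eval_def)

lemma mpoly_eval_mvar [simp]: "mpoly_eval s (mvar v) = s v"
  by (simp add: mvar_def mpoly_eval_single mono_eval_def)

lemma mpoly_eval_sum: "mpoly_eval s (\<Sum>i\<in>I. g i) = (\<Sum>i\<in>I. mpoly_eval s (g i))"
  by (induction I rule: infinite_finite_induct) (auto simp: mpoly_eval_add)

lemma mpoly_eval_minus: "mpoly_eval s (- p) = - mpoly_eval s p"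
  by (metis add.right_inverse mpoly_eval_0 mpoly_eval_add neg_eq_iff_add_eq_0)

lemma mpoly_eval_diff: "mpoly_eval s (p - q) = mpoly_eval s p - mpoly_eval s q"
  by (metis diff_conv_add_uminus mpoly_eval_add mpoly_eval_minus)

lemma int_mpoly_sum_monomials:
  fixes p :: "'v int_mpoly"
  shows "p = (\<Sum>m\<in>Poly_Mapping.keys p. Poly_Mapping.single m (Poly_Mapping.lookup p m))"
proof (rule poly_mapping_eqI)
  fix k
  show "Poly_Mapping.lookup p k =
    Poly_Mapping.lookup (\<Sum>m\<in>Poly_Mapping.keys p. Poly_Mapping.single m (Poly_Mapping.lookup p m)) k"
    by (auto simp: lookup_sum lookup_single when_def in_keys_iff)
qed

lemma mpoly_eval_mult: "mpoly_eval s (p * q) = mpoly_eval s p * mpoly_eval s q"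
proof -
  have "p * q = (\<Sum>a\<in>Poly_Mapping.keys p. \<Sum>b\<in>Poly_Mapping.keys q.
      Poly_Mapping.single (a + b) (Poly_Mapping.lookup p a * Poly_Mapping.lookup q b))"
    by (subst int_mpoly_sum_monomials[of p], subst int_mpoly_sum_monomials[of q])
      (simp add: sum_product mult_single)
  then have "mpoly_eval s (p * q) = (\<Sum>a\<in>Poly_Mapping.keys p. \<Sum>b\<in>Poly_Mapping.keys q.
      of_int (Poly_Mapping.lookup p a * Poly_Mapping.lookup q b) * mono_eval s (a + b))"
    by (simp add: mpoly_eval_sum mpoly_eval_single)
  also have "\<dots> = mpoly_eval s p * mpoly_eval s q"
    unfolding mpoly_eval_def sum_product
    by (intro sum.cong refl) (simp add: mono_eval_add mult_ac)
  finally show ?thesis .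
qed

lemma term_at_map_Inl: "term_at c (map_gcd_term Inl t) = of_int (int_value c t)"
  by (induction t) (simp_all add: term_at_def subst_C_def const_colon_def lookup_of_int)

lemma term_at_plug_in:
  assumes "ring_term f"
  shows "term_at c (plug_in ts f) = mpoly_at (\<lambda>l. int_value c (ts l)) (ring_term_poly f)"
  using assms
proof (induction f)
  case (GVar v)
  show ?case
  proof (cases v)
    case (Inl l)
    then show ?thesis
      by (simp add: plug_in_def term_at_map_Inl mpoly_at_def ring_term_poly_def subst_C_def)
  next
    case (Inr j)
    then show ?thesis
      by (simp add: plug_in_def term_at_def mpoly_at_def ring_term_poly_def subst_C_def)
  qed
qed (simp_all add: plug_in_def term_at_def mpoly_at_def ring_term_poly_def mpoly_eval_add
    mpoly_eval_diff mpoly_eval_mult)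

text \<open>Tuples of length \<open>n\<close> are functions in \<open>{..<n} \<rightarrow>\<^sub>E A\<close>.\<close>

definition solution_module :: "nat \<Rightarrow> nat \<Rightarrow> (nat \<Rightarrow> nat int_mpoly) \<Rightarrow> (nat \<Rightarrow> nat int_mpoly) set" where
  "solution_module N n g = {y \<in> {..<n} \<rightarrow>\<^sub>E mpolys {..<N}. (\<Sum>i<n. g i * y i) = 0}"

text \<open>The submodule generated by the vectors \<open>w 0, \<dots>, w (K - 1)\<close>, where \<open>w k i\<close> is the \<open>i\<close>-th
  entry of \<open>w k\<close>.\<close>

definition generated_module ::
  "nat \<Rightarrow> nat \<Rightarrow> nat \<Rightarrow> (nat \<Rightarrow> nat \<Rightarrow> nat int_mpoly) \<Rightarrow> (nat \<Rightarrow> nat int_mpoly) set" where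
  "generated_module N n K w =
     {\<lambda>i\<in>{..<n}. \<Sum>k<K. a k * w k i | a. a \<in> {..<K} \<rightarrow> mpolys {..<N}}"

end

theory Submission
  imports Defs Complex_Main "HOL-Library.Product_Lexorder" "HOL-Computational_Algebra.Primes"
begin

text \<open>One family of vectors of terms works for all parameters \<open>c\<close>. This rests on two facts.

The first is a degree bound (\<open>syzygies_degree_bound\<close>): the syzygies of \<open>n\<close> polynomials of degree at
most \<open>d\<close> over \<open>\<int>\<close> are generated by those of degree at most \<open>D\<close>, where \<open>D\<close> depends only on \<open>N\<close>, \<open>n\<close>
and \<open>d\<close>. In a fixed degree the syzygies are the kernel of an integer matrix. Let \<open>p\<close> be zero or a
prime, and consider the leading positions of the syzygies modulo \<open>p\<close> and the leading monomials of
the values \<open>\<Sum>i. g i * y i\<close> over the rationals. Both sets are closed under multiplication by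
monomials. By rank-nullity (\<open>rank_nullity_lead_sets\<close>) they have together a Hilbert function that is
the same for all \<open>g\<close> and \<open>p\<close>: kernels of integer matrices are pure, so that reduction modulo \<open>p\<close>
preserves their rank. Only finitely many monomial modules have a given Hilbert function
(\<open>uniform_generation_bound\<close>), so the leading positions are generated in degrees up to some \<open>D\<close>
uniformly in \<open>g\<close> and \<open>p\<close>. For fixed \<open>g\<close>, a Nakayama argument over all \<open>p\<close>
(\<open>submodule_eqI_lead_sets\<close>) passes from leading positions to the syzygies themselves. It works in
one degree at a time, where everything is finitely generated over \<open>\<int>\<close>.

The second fact concerns linear algebra (\<open>definable_kernel_generators\<close>). Bounding the degree turns
the problem into a homogeneous linear system over \<open>\<int>\<close> for the coefficients of \<open>y\<close>, with a matrix
whose entries are polynomials in \<open>c\<close>. For one equation \<open>\<Sum>i. t i * z i = 0\<close> the solutions are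
generated by the vectors \<open>(t j : t i) e\<^sub>i - (t i : t j) e\<^sub>j\<close> and \<open>(0 : t i) e\<^sub>i\<close>, where \<open>e\<^sub>i\<close> are the
unit vectors. Their entries are terms in the \<open>t i\<close>, and imposing the equations of a system one
after the other only composes such terms. Bezout coefficients are not given by terms, but they are
used only to prove that these vectors generate.\<close>

section \<open>Leading positions of integer vectors\<close>

lemma underdetermined_int_system:
  fixes a :: "'c \<Rightarrow> 'b \<Rightarrow> int"
  assumes "finite E" "finite B" "card E < card B"
  shows "\<exists>y. (\<exists>b\<in>B. y b \<noteq> 0) \<and> (\<forall>b. b \<notin> B \<longrightarrow> y b = 0) \<and> (\<forall>e\<in>E. (\<Sum>b\<in>B. a e b * y b) = 0)"
  using assms
proof (induction E arbitrary: a B rule: finite_induct)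
  case empty
  then obtain b where "b \<in> B" by fastforce
  then show ?case by (intro exI[of _ "\<lambda>x. if x = b then 1 else 0"]) auto
next
  case (insert e E)
  show ?case
  proof (cases "\<forall>b\<in>B. a e b = 0")
    case True
    have "card E < card B" using insert.prems insert.hyps by simp
    from insert.IH[OF \<open>finite B\<close> this, of a] obtain y where "\<exists>b\<in>B. y b \<noteq> 0"
      "\<forall>b. b \<notin> B \<longrightarrow> y b = 0" "\<forall>e'\<in>E. (\<Sum>b\<in>B. a e' b * y b) = 0" by blast
    then show ?thesis using True by (intro exI[of _ y]) auto
  next
    case False
    then obtain p where p: "p \<in> B" "a e p \<noteq> 0" by blast
    let ?B = "B - {p}"
    let ?a = "\<lambda>e' b. a e p * a e' b - a e' p * a e b"
    have "finite ?B" "card E < card ?B" using insert p by auto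
    then obtain y where y: "\<exists>b\<in>?B. y b \<noteq> 0" "\<forall>b. b \<notin> ?B \<longrightarrow> y b = 0"
      "\<forall>e'\<in>E. (\<Sum>b\<in>?B. ?a e' b * y b) = 0"
      using insert.IH[of ?B ?a] by blast
    \<comment> \<open>One step of Gaussian elimination: the equation \<open>e\<close> is solved for the unknown at the pivot \<open>p\<close>,
      with denominators cleared.\<close>
    define z where "z b = (if b = p then - (\<Sum>b\<in>?B. a e b * y b) else a e p * y b)" for b
    have split: "(\<Sum>b\<in>B. a e' b * z b) = a e' p * z p + (\<Sum>b\<in>?B. a e' b * z b)" for e'
      using insert.prems p by (simp add: sum.remove)
    have rest: "(\<Sum>b\<in>?B. a e' b * z b) = a e p * (\<Sum>b\<in>?B. a e' b * y b)" for e'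
      unfolding sum_distrib_left by (rule sum.cong) (auto simp: z_def)
    have sys: "(\<Sum>b\<in>B. a e' b * z b) =
        a e p * (\<Sum>b\<in>?B. a e' b * y b) - a e' p * (\<Sum>b\<in>?B. a e b * y b)" for e'
      unfolding split rest by (simp add: z_def)
    have "(\<Sum>b\<in>B. a e b * z b) = 0" unfolding sys by simp
    moreover have "(\<Sum>b\<in>B. a e' b * z b) = 0" if "e' \<in> E" for e'
    proof -
      have "(\<Sum>b\<in>?B. ?a e' b * y b) = 0" using y(3) that by blast
      then show ?thesis unfolding sys
        by (simp add: algebra_simps sum_subtractf sum_distrib_left)
    qed
    moreover have "\<exists>b\<in>B. z b \<noteq> 0" using y(1) p by (auto simp: z_def)
    moreover have "\<forall>b. b \<notin> B \<longrightarrow> z b = 0" using y(2) p by (auto simp: z_def)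
    ultimately show ?thesis by blast
  qed
qed

text \<open>The highest positions of the vectors in \<open>M\<close> modulo \<open>p\<close>. Divisibility by \<open>p = 0\<close> means vanishing,
so the one definition covers leading positions over the rationals (\<open>p = 0\<close>) and over the fields with
\<open>p\<close> elements, and proofs about the two need not be duplicated.\<close>

definition lead_set :: "int \<Rightarrow> ('b::linorder \<Rightarrow> int) set \<Rightarrow> 'b set" where
  "lead_set p M = {b. \<exists>y\<in>M. \<not> p dvd y b \<and> (\<forall>b'>b. p dvd y b')}"

definition zero_or_prime :: "int \<Rightarrow> bool" where
  "zero_or_prime p \<longleftrightarrow> p = 0 \<or> prime p"

text \<open>Kernels of integer matrices are pure. Purity is what makes them behave well modulo \<open>p\<close>: an
element that vanishes modulo \<open>p\<close> is \<open>p\<close> times another element.\<close>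

definition pure_set :: "('b \<Rightarrow> int) set \<Rightarrow> bool" where
  "pure_set M \<longleftrightarrow> (\<forall>k y. k \<noteq> 0 \<longrightarrow> (\<lambda>b. k * y b) \<in> M \<longrightarrow> y \<in> M)"

lemma zero_or_prime_dvd_multD:
  assumes "zero_or_prime p" "p dvd a * b" shows "p dvd a \<or> p dvd b"
  using assms by (auto simp: zero_or_prime_def prime_dvd_mult_iff)

text \<open>Vectors with distinct leading positions are in echelon form, hence independent modulo \<open>p\<close>.\<close>

lemma leading_vectors_independent:
  fixes y :: "'b::linorder \<Rightarrow> 'b \<Rightarrow> int"
  assumes p: "zero_or_prime p" and "finite L"
    and lead: "\<And>b. b \<in> L \<Longrightarrow> \<not> p dvd y b b \<and> (\<forall>b'>b. p dvd y b b')"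
    and rel: "\<And>x. p dvd (\<Sum>b\<in>L. k b * y b x)"
  shows "\<forall>b\<in>L. p dvd k b"
proof (rule ccontr)
  let ?S = "{b\<in>L. \<not> p dvd k b}"
  assume "\<not> ?thesis"
  then have S: "finite ?S" "?S \<noteq> {}" using \<open>finite L\<close> by auto
  define m where "m = Max ?S"
  have m: "m \<in> L" "\<not> p dvd k m" using Max_in[OF S] by (auto simp: m_def)
  have "p dvd k b * y b m" if "b \<in> L - {m}" for b
  proof (cases "p dvd k b")
    case False
    then have "b \<in> ?S" using that by auto
    then have "b < m" using Max_ge[OF S(1)] that by (fastforce simp: m_def less_le)
    then show ?thesis using lead that by auto
  qed auto
  then have "p dvd (\<Sum>b\<in>L - {m}. k b * y b m)" by (rule dvd_sum)
  moreover have "p dvd k m * y m m + (\<Sum>b\<in>L - {m}. k b * y b m)"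
    using rel[of m] m \<open>finite L\<close> by (simp add: sum.remove)
  ultimately have "p dvd k m * y m m" using dvd_add_left_iff by blast
  then show False using zero_or_prime_dvd_multD[OF p] m lead by blast
qed

text \<open>Dividing a nonzero vector by its content makes it nonzero modulo every prime, and trivially leaves
it nonzero over the integers. This is the passage from rational to modulo-\<open>p\<close> independence.\<close>

lemma primitive_part:
  fixes y :: "'b \<Rightarrow> int"
  assumes p: "zero_or_prime p" and "y b \<noteq> 0"
  obtains k z where "k \<noteq> 0" "\<And>x. y x = k * z x" "\<exists>x. \<not> p dvd z x"
proof -
  define k where "k = Gcd (range y)"
  have k0: "k \<noteq> 0" unfolding k_def using assms(2) by (auto simp: Gcd_0_iff)
  have kd: "k dvd y x" for x unfolding k_def by (simp add: Gcd_dvd)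
  have "\<exists>x. \<not> p dvd y x div k"
  proof (rule ccontr)
    assume "\<not> ?thesis"
    then have "k * p dvd y x" for x
      using kd[of x] k0 by (metis dvd_div_mult_self mult.commute mult_dvd_mono dvd_refl)
    then have "k * p dvd Gcd (range y)" by (intro Gcd_greatest) blast
    then have "k * p dvd k * 1" by (simp add: k_def)
    then have "p dvd 1" using k0 by (metis dvd_mult_cancel_left)
    then show False using p by (auto simp: zero_or_prime_def)
  qed
  then show ?thesis using k0 kd by (intro that[of k "\<lambda>x. y x div k"]) auto
qed

lemma leading_position:
  fixes z :: "'b::linorder \<Rightarrow> int"
  assumes "finite {b. \<not> p dvd z b}" "\<not> p dvd z b"
  obtains m where "\<not> p dvd z m" "\<forall>b'>m. p dvd z b'"
proof
  let ?S = "{b. \<not> p dvd z b}"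
  have "?S \<noteq> {}" using assms(2) by blast
  then show "\<not> p dvd z (Max ?S)" using Max_in[OF assms(1)] by blast
  show "\<forall>b'>Max ?S. p dvd z b'"
  proof (intro allI impI)
    fix b' assume "b' > Max ?S"
    then have "b' \<notin> ?S" using Max_ge[OF assms(1), of b'] by (meson leD)
    then show "p dvd z b'" by simp
  qed
qed

text \<open>The projection of a pure module to its leading positions is injective: after division by its
content, a nonzero element of the kernel would have a leading position among those positions.\<close>

lemma vanishing_on_lead_set:
  fixes M :: "('b::linorder \<Rightarrow> int) set"
  assumes p: "zero_or_prime p" and "pure_set M" and y: "y \<in> M"
    and "finite B" and supp: "\<And>b. b \<notin> B \<Longrightarrow> y b = 0"
    and van: "\<And>b. b \<in> lead_set p M \<Longrightarrow> y b = 0"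
  shows "y b = 0"
proof (rule ccontr)
  assume "y b \<noteq> 0"
  from primitive_part[of p y b, OF p this] obtain k z
    where k: "k \<noteq> 0" and yz: "\<And>x. y x = k * z x" and z: "\<exists>x. \<not> p dvd z x" by blast
  have "y = (\<lambda>b. k * z b)" using yz by auto
  then have zM: "z \<in> M" using \<open>pure_set M\<close> y k by (auto simp: pure_set_def)
  let ?S = "{b. \<not> p dvd z b}"
  have "?S \<subseteq> B"
  proof (rule ccontr)
    assume "\<not> ?S \<subseteq> B"
    then obtain b where "b \<notin> B" "\<not> p dvd z b" by auto
    then have "z b = 0" using supp[of b] yz[of b] k by simp
    then show False using \<open>\<not> p dvd z b\<close> by simp
  qed
  then have "finite ?S" using \<open>finite B\<close> by (rule finite_subset)
  then obtain m where m: "\<not> p dvd z m" "\<forall>b'>m. p dvd z b'" using leading_position z by blast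
  then have "m \<in> lead_set p M" using zM by (auto simp: lead_set_def)
  then have "k * z m = 0" using van yz by simp
  then show False using m k by simp
qed

definition supported :: "'b set \<Rightarrow> ('b \<Rightarrow> int) set" where
  "supported B = {y. \<forall>b. b \<notin> B \<longrightarrow> y b = 0}"

definition matrix_map :: "'b set \<Rightarrow> 'c set \<Rightarrow> ('c \<Rightarrow> 'b \<Rightarrow> int) \<Rightarrow> ('b \<Rightarrow> int) \<Rightarrow> 'c \<Rightarrow> int" where
  "matrix_map B C a y = (\<lambda>c. if c \<in> C then \<Sum>b\<in>B. a c b * y b else 0)"

definition matrix_kernel :: "'b set \<Rightarrow> 'c set \<Rightarrow> ('c \<Rightarrow> 'b \<Rightarrow> int) \<Rightarrow> ('b \<Rightarrow> int) set" where
  "matrix_kernel B C a = {y \<in> supported B. matrix_map B C a y = (\<lambda>_. 0)}"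

lemma pure_matrix_kernel: "pure_set (matrix_kernel B C a)"
  unfolding pure_set_def
proof (intro allI impI)
  fix k y assume k: "k \<noteq> (0::int)" and "(\<lambda>b. k * y b) \<in> matrix_kernel B C a"
  then have V: "(\<lambda>b. k * y b) \<in> supported B"
    and z: "matrix_map B C a (\<lambda>b. k * y b) = (\<lambda>_. 0)" by (auto simp: matrix_kernel_def)
  have "matrix_map B C a (\<lambda>b. k * y b) c = k * matrix_map B C a y c" for c
    by (simp add: matrix_map_def sum_distrib_left mult_ac)
  then have "k * matrix_map B C a y c = 0" for c using fun_cong[OF z, of c] by simp
  then show "y \<in> matrix_kernel B C a" using V k by (auto simp: matrix_kernel_def supported_def)
qed

text \<open>The rank-nullity theorem, with the kernel counted modulo \<open>p\<close> and the image counted over the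
rationals. The second summand does not depend on \<open>p\<close>, so the number of leading positions of the
kernel is the same for every \<open>p\<close>. Both inequalities come from a system with more unknowns than
equations: a nonzero vector that vanishes at all the positions counted on the left, and a relation
among too many echelon vectors.\<close>

lemma rank_nullity_lead_sets:
  fixes a :: "'c::linorder \<Rightarrow> 'b::linorder \<Rightarrow> int"
  assumes p: "zero_or_prime p" and B: "finite B" and C: "finite C"
  shows "card (lead_set p (matrix_kernel B C a)) + card (lead_set 0 (matrix_map B C a ` supported B)) =
    card B"
proof -
  define T where "T = matrix_map B C a"
  define M where "M = matrix_kernel B C a"
  define V where "V = supported B"
  have M_iff: "y \<in> M \<longleftrightarrow> y \<in> V \<and> T y = (\<lambda>_. 0)" for y
    by (simp add: M_def T_def V_def matrix_kernel_def)
  have V_iff: "y \<in> V \<longleftrightarrow> (\<forall>b. b \<notin> B \<longrightarrow> y b = 0)" for y by (simp add: V_def supported_def)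
  have T_eq: "T y c = (if c \<in> C then \<Sum>b\<in>B. a c b * y b else 0)" for y c
    by (simp add: T_def matrix_map_def)
  let ?P = "lead_set p M" and ?Q = "lead_set 0 (T ` V)"
  have PB: "?P \<subseteq> B"
  proof
    fix b assume "b \<in> ?P"
    then obtain y where "y \<in> M" "\<not> p dvd y b" by (auto simp: lead_set_def)
    then show "b \<in> B" by (cases "b \<in> B") (auto simp: M_iff V_iff)
  qed
  have QC: "?Q \<subseteq> C" by (auto simp: lead_set_def T_eq split: if_splits)
  have fin: "finite ?P" "finite ?Q" using PB QC B C by (auto intro: finite_subset)
  have pure: "pure_set M" unfolding M_def by (rule pure_matrix_kernel)
  have "\<not> card ?P + card ?Q < card B"
  proof
    assume less: "card ?P + card ?Q < card B"
    define e where "e = (\<lambda>x b. case x of Inl q \<Rightarrow> (if b = q then 1 else 0) | Inr c \<Rightarrow> a c b)"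
    have "card (?P <+> ?Q) < card B" "finite (?P <+> ?Q)"
      using less fin by (auto simp: card_Plus)
    from underdetermined_int_system[OF this(2) B this(1), of e] obtain y
      where y: "\<exists>b\<in>B. y b \<noteq> 0" "\<forall>b. b \<notin> B \<longrightarrow> y b = 0"
        and sol: "\<forall>x\<in>?P <+> ?Q. (\<Sum>b\<in>B. e x b * y b) = 0" by blast
    have yV: "y \<in> V" using y by (simp add: V_iff)
    have yP: "y b = 0" if "b \<in> ?P" for b
    proof -
      have "(\<Sum>x\<in>B. e (Inl b) x * y x) = 0" using sol that by blast
      also have "(\<Sum>x\<in>B. e (Inl b) x * y x) = (\<Sum>x\<in>B. if x = b then y x else 0)"
        by (rule sum.cong) (auto simp: e_def)
      also have "\<dots> = y b" using B that PB by (auto simp: sum.delta)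
      finally show ?thesis .
    qed
    have Q0: "T y c = 0" if "c \<in> ?Q" for c
      using bspec[OF sol, of "Inr c"] that by (auto simp: e_def T_eq)
    have Ty: "T y c = 0" for c
    proof (rule ccontr)
      assume nz: "T y c \<noteq> 0"
      have "{c. \<not> 0 dvd T y c} \<subseteq> C" by (auto simp: T_eq)
      then have "finite {c. \<not> 0 dvd T y c}" using C by (rule finite_subset)
      then obtain m where m: "\<not> 0 dvd T y m" "\<forall>c'>m. 0 dvd T y c'"
        using leading_position[of 0 "T y" c] nz by auto
      then have "m \<in> ?Q" using yV unfolding lead_set_def by blast
      then show False using Q0 m by simp
    qed
    then have "y \<in> M" using yV by (auto simp: M_iff)
    from vanishing_on_lead_set[OF p pure this B] have "y b = 0" for b using y(2) yP by blast
    then show False using y(1) by blast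
  qed
  moreover have "\<not> card B < card ?P + card ?Q"
  proof
    assume less: "card B < card ?P + card ?Q"
    have "\<forall>b\<in>?P. \<exists>y. y \<in> M \<and> \<not> p dvd y b \<and> (\<forall>b'>b. p dvd y b')"
      by (auto simp: lead_set_def)
    then obtain y where y: "\<And>b. b \<in> ?P \<Longrightarrow> y b \<in> M \<and> \<not> p dvd y b b \<and> (\<forall>b'>b. p dvd y b b')"
      by metis
    have "\<forall>c\<in>?Q. \<exists>z. z \<in> V \<and> \<not> 0 dvd T z c \<and> (\<forall>c'>c. 0 dvd T z c')"
      by (auto simp: lead_set_def)
    then obtain z where z: "\<And>c. c \<in> ?Q \<Longrightarrow> z c \<in> V \<and> \<not> 0 dvd T (z c) c \<and> (\<forall>c'>c. 0 dvd T (z c) c')"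
      by metis
    define u where "u = (\<lambda>b x. case x of Inl q \<Rightarrow> y q b | Inr c \<Rightarrow> z c b)"
    have "card B < card (?P <+> ?Q)" "finite (?P <+> ?Q)"
      using less fin by (auto simp: card_Plus)
    from underdetermined_int_system[OF B this(2,1), of u] obtain k
      where k: "\<exists>x\<in>?P <+> ?Q. k x \<noteq> 0" "\<forall>x. x \<notin> ?P <+> ?Q \<longrightarrow> k x = 0"
        and "\<forall>b\<in>B. (\<Sum>x\<in>?P <+> ?Q. u b x * k x) = 0" by blast
    then have sol: "(\<Sum>q\<in>?P. k (Inl q) * y q b) + (\<Sum>c\<in>?Q. k (Inr c) * z c b) = 0" if "b \<in> B" for b
      using fin that by (simp add: sum.Plus u_def mult_ac)
    have Tsum: "(\<Sum>i\<in>I. k i * T (v i) c) = (if c \<in> C then \<Sum>b\<in>B. a c b * (\<Sum>i\<in>I. k i * v i b) else 0)"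
      for I :: "'i set" and k v c
      by (auto simp: T_eq sum_distrib_left mult_ac intro: sum.swap)
    have "(\<Sum>c\<in>?Q. k (Inr c) * T (z c) x) = 0" for x
    proof -
      have "(\<Sum>q\<in>?P. k (Inl q) * T (y q) x) + (\<Sum>c\<in>?Q. k (Inr c) * T (z c) x) =
         (if x \<in> C then \<Sum>b\<in>B. a x b * ((\<Sum>q\<in>?P. k (Inl q) * y q b) + (\<Sum>c\<in>?Q. k (Inr c) * z c b)) else 0)"
        unfolding Tsum by (simp add: distrib_left sum.distrib)
      also have "\<dots> = 0" using sol by simp
      finally show ?thesis using y by (simp add: M_iff)
    qed
    then have "\<forall>c\<in>?Q. 0 dvd k (Inr c)"
      using z by (intro leading_vectors_independent[of 0 ?Q "\<lambda>c. T (z c)"] fin)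
        (auto simp: zero_or_prime_def)
    then have kQ: "k (Inr c) = 0" for c using k(2) by (cases "c \<in> ?Q") auto
    have ky: "(\<Sum>q\<in>?P. k (Inl q) * y q b) = 0" for b
    proof (cases "b \<in> B")
      case True then show ?thesis using sol[OF True] kQ by simp
    next
      case False
      then have "y q b = 0" if "q \<in> ?P" for q using y[OF that] by (auto simp: M_iff V_iff)
      then show ?thesis by simp
    qed
    obtain q where "k (Inl q) \<noteq> 0" using k(1) kQ by auto
    from primitive_part[of p "\<lambda>q. k (Inl q)" q, OF p this] obtain g l
      where g: "g \<noteq> 0" "\<And>q. k (Inl q) = g * l q" "\<exists>q. \<not> p dvd l q" by blast
    have "g * (\<Sum>q\<in>?P. l q * y q b) = 0" for b
      using ky[of b] g(2) by (simp add: sum_distrib_left mult_ac)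
    then have "(\<Sum>q\<in>?P. l q * y q b) = 0" for b using g(1) by simp
    then have "\<forall>q\<in>?P. p dvd l q"
      using y by (intro leading_vectors_independent[OF p fin(1), of y]) auto
    moreover have "l q = 0" if "q \<notin> ?P" for q
    proof -
      have "k (Inl q) = 0" using k(2) that by auto
      then show ?thesis using g(1,2) by auto
    qed
    ultimately show False using g(3) by (metis dvd_0_right)
  qed
  ultimately show ?thesis unfolding M_def T_def V_def by linarith
qed

definition int_submodule :: "('b \<Rightarrow> int) set \<Rightarrow> bool" where
  "int_submodule M \<longleftrightarrow> (\<lambda>_. 0) \<in> M \<and>
     (\<forall>y\<in>M. \<forall>z\<in>M. \<forall>k l. (\<lambda>b. k * y b + l * z b) \<in> M)"

lemma int_submoduleD:
  assumes "int_submodule M" "y \<in> M" "z \<in> M"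
  shows "(\<lambda>b. k * y b + l * z b) \<in> M"
  using assms by (auto simp: int_submodule_def)

text \<open>Division with remainder modulo \<open>p\<close>, from the highest position downwards. The remainder is
divisible by \<open>p\<close>, and by purity its quotient by \<open>p\<close> lies in \<open>M\<close> again.\<close>

lemma reduce_mod_prime:
  fixes M N :: "('b::linorder \<Rightarrow> int) set"
  assumes p: "prime p" and "pure_set M" and M: "int_submodule M" and N: "int_submodule N"
    and "N \<subseteq> M" and "finite B" and supp: "\<And>y b. y \<in> M \<Longrightarrow> b \<notin> B \<Longrightarrow> y b = 0"
    and lead: "lead_set p M \<subseteq> lead_set p N" and "y \<in> M"
  shows "\<exists>z\<in>N. \<exists>w\<in>M. \<forall>b. y b = z b + p * w b"
proof -
  have "\<forall>y\<in>M. S \<subseteq> B \<longrightarrow> (\<forall>x\<in>B. \<forall>s\<in>S. x \<le> s \<longrightarrow> x \<in> S) \<longrightarrow> (\<forall>b. b \<notin> S \<longrightarrow> p dvd y b) \<longrightarrow>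
     (\<exists>z\<in>N. \<exists>w\<in>M. \<forall>b. y b = z b + p * w b)" if "finite S" for S
    using that
  proof (induction S rule: finite_linorder_max_induct)
    case empty
    show ?case
    proof (intro ballI impI)
      fix y assume y: "y \<in> M" "\<forall>b. b \<notin> {} \<longrightarrow> p dvd y b"
      then have eq: "y b = p * (y b div p)" for b by simp
      then have "(\<lambda>b. p * (y b div p)) \<in> M" using y(1) by simp
      then have "(\<lambda>b. y b div p) \<in> M" using \<open>pure_set M\<close> p unfolding pure_set_def
        by (metis not_prime_0)
      moreover have "(\<lambda>_. 0) \<in> N" using N by (simp add: int_submodule_def)
      ultimately show "\<exists>z\<in>N. \<exists>w\<in>M. \<forall>b. y b = z b + p * w b" using eq by force
    qed
  next
    case (insert m S)
    show ?case
    proof (intro ballI impI)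
      fix y assume y: "y \<in> M" and sub: "insert m S \<subseteq> B"
        and down: "\<forall>x\<in>B. \<forall>s\<in>insert m S. x \<le> s \<longrightarrow> x \<in> insert m S"
        and dv: "\<forall>b. b \<notin> insert m S \<longrightarrow> p dvd y b"
      have down': "\<forall>x\<in>B. \<forall>s\<in>S. x \<le> s \<longrightarrow> x \<in> S" using down insert.hyps by fastforce
      have S: "x \<in> S" if "x \<in> B" "x < m" for x using down that by fastforce
      have IH: "\<exists>z\<in>N. \<exists>w\<in>M. \<forall>b. y' b = z b + p * w b"
        if "y' \<in> M" "\<forall>b. b \<notin> S \<longrightarrow> p dvd y' b" for y'
        using insert.IH sub down' that by blast
      show "\<exists>z\<in>N. \<exists>w\<in>M. \<forall>b. y b = z b + p * w b"
      proof (cases "p dvd y m")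
        case True
        then have "\<forall>b. b \<notin> S \<longrightarrow> p dvd y b" using dv by auto
        then show ?thesis using IH[OF y] by blast
      next
        case False
        have up: "p dvd y b" if "b > m" for b using dv insert.hyps that by fastforce
        then have "m \<in> lead_set p N" using lead False y by (auto simp: lead_set_def)
        then obtain z where z: "z \<in> N" "\<not> p dvd z m" "\<forall>b>m. p dvd z b" by (auto simp: lead_set_def)
        have "coprime (z m) p" using p z(2) by (metis coprime_commute prime_imp_coprime)
        then obtain i j where ij: "i * z m + j * p = 1" using coprime_iff_gcd_eq_1 bezout_int by metis
        have "y m - y m * i * z m = p * (y m * j)" 
          using arg_cong[OF ij, of "\<lambda>x. y m * x"] by (simp add: algebra_simps)
        then have pm: "p dvd 1 * y m + (- (y m * i)) * z m" by simp
        \<comment> \<open>As \<open>i\<close> inverts \<open>z m\<close> modulo \<open>p\<close>, subtracting \<open>y m * i\<close> times \<open>z\<close> removes the position \<open>m\<close>.\<close>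
        have "(\<lambda>b. 1 * y b + (- (y m * i)) * z b) \<in> M"
          using int_submoduleD[OF M y] z \<open>N \<subseteq> M\<close> by blast
        moreover have "p dvd 1 * y b + (- (y m * i)) * z b" if "b \<notin> S" for b
        proof (cases "b \<in> B")
          case True
          then have "\<not> b < m" using S[OF True] that by blast
          then consider "b = m" | "b > m" by (cases b m rule: linorder_cases) auto
          then show ?thesis using pm up z(3) by cases (auto simp: dvd_add dvd_mult)
        next
          case False
          then show ?thesis using supp[OF y] supp[of z] z(1) \<open>N \<subseteq> M\<close> by auto
        qed
        ultimately obtain z' w where z': "z' \<in> N" "w \<in> M"
          "\<forall>b. 1 * y b + (- (y m * i)) * z b = z' b + p * w b" using IH by blast
        have "(\<lambda>b. 1 * z' b + (y m * i) * z b) \<in> N" using int_submoduleD[OF N z'(1) z(1)] .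
        moreover have "\<forall>b. y b = (1 * z' b + (y m * i) * z b) + p * w b"
        proof
          fix b
          show "y b = (1 * z' b + (y m * i) * z b) + p * w b"
            using spec[OF z'(3), of b] by (simp add: algebra_simps)
        qed
        ultimately show ?thesis using z'(2)
          by (intro bexI[of _ "\<lambda>b. 1 * z' b + (y m * i) * z b"] bexI[of _ w])
      qed
    qed
  qed
  from this[OF \<open>finite B\<close>] show ?thesis using \<open>y \<in> M\<close> supp by (metis dvd_0_right order_refl)
qed

text \<open>The same elimination over the rationals, with denominators cleared. Since the positions are
finite in number, one multiplier serves all of \<open>M\<close>.\<close>

lemma common_denominator:
  fixes M N :: "('b::linorder \<Rightarrow> int) set"
  assumes M: "int_submodule M" and N: "int_submodule N"
    and "N \<subseteq> M" and "finite B" and supp: "\<And>y b. y \<in> M \<Longrightarrow> b \<notin> B \<Longrightarrow> y b = 0"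
    and lead: "lead_set 0 M \<subseteq> lead_set 0 N"
  shows "\<exists>k. k \<noteq> 0 \<and> (\<forall>y\<in>M. (\<lambda>b. k * y b) \<in> N)"
proof -
  have "S \<subseteq> B \<longrightarrow> (\<forall>x\<in>B. \<forall>s\<in>S. x \<le> s \<longrightarrow> x \<in> S) \<longrightarrow>
     (\<exists>k. k \<noteq> 0 \<and> (\<forall>y\<in>M. (\<forall>b. b \<notin> S \<longrightarrow> y b = 0) \<longrightarrow> (\<lambda>b. k * y b) \<in> N))" if "finite S" for S
    using that
  proof (induction S rule: finite_linorder_max_induct)
    case empty
    show ?case
    proof (intro impI exI[of _ 1] conjI ballI)
      fix y :: "'b \<Rightarrow> int" assume "\<forall>b. b \<notin> {} \<longrightarrow> y b = 0"
      then have "(\<lambda>b. 1 * y b) = (\<lambda>_. 0)" by auto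
      then show "(\<lambda>b. 1 * y b) \<in> N" using N by (metis int_submodule_def)
    qed auto
  next
    case (insert m S)
    show ?case
    proof (intro impI)
      assume sub: "insert m S \<subseteq> B"
        and down: "\<forall>x\<in>B. \<forall>s\<in>insert m S. x \<le> s \<longrightarrow> x \<in> insert m S"
      have down': "\<forall>x\<in>B. \<forall>s\<in>S. x \<le> s \<longrightarrow> x \<in> S" using down insert.hyps by fastforce
      have S: "x \<in> S" if "x \<in> B" "x < m" for x using down that by fastforce
      have "S \<subseteq> B" using sub by blast
      from mp[OF mp[OF insert.IH this] down'] obtain k where k0: "k \<noteq> 0"
        and "\<forall>y\<in>M. (\<forall>b. b \<notin> S \<longrightarrow> y b = 0) \<longrightarrow> (\<lambda>b. k * y b) \<in> N" by (elim exE conjE)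
      then have k: "(\<lambda>b. k * y b) \<in> N" if "y \<in> M" "\<And>b. b \<notin> S \<Longrightarrow> y b = 0" for y
        using that by simp
      show "\<exists>k. k \<noteq> 0 \<and> (\<forall>y\<in>M. (\<forall>b. b \<notin> insert m S \<longrightarrow> y b = 0) \<longrightarrow> (\<lambda>b. k * y b) \<in> N)"
      proof (cases "m \<in> lead_set 0 N")
        case True
        then obtain z where z: "z \<in> N" "z m \<noteq> 0" "\<forall>b>m. z b = 0" by (auto simp: lead_set_def)
        show ?thesis
        proof (intro exI[of _ "k * z m"] conjI ballI impI)
          fix y assume y: "y \<in> M" "\<forall>b. b \<notin> insert m S \<longrightarrow> y b = 0"
          let ?y = "\<lambda>b. z m * y b + (- y m) * z b"
          have "?y \<in> M" using int_submoduleD[OF M y(1)] z(1) \<open>N \<subseteq> M\<close> by blast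
          moreover have "?y b = 0" if "b \<notin> S" for b
          proof (cases "b \<in> B")
            case True
            then have "\<not> b < m" using S[OF True] that by blast
          then consider "b = m" | "b > m" by (cases b m rule: linorder_cases) auto
            then show ?thesis
            proof cases
              case 2
              then show ?thesis using y(2) that z(3) by auto
            qed auto
          next
            case False
            then show ?thesis using supp[OF y(1)] supp[of z] z(1) \<open>N \<subseteq> M\<close> by auto
          qed
          ultimately have "(\<lambda>b. k * ?y b) \<in> N" by (rule k)
          from int_submoduleD[OF N this z(1), of 1 "k * y m"]
          show "(\<lambda>b. k * z m * y b) \<in> N" by (simp add: algebra_simps)
        qed (use k0 z in auto)
      next
        case False
        have "(\<lambda>b. k * y b) \<in> N" if y: "y \<in> M" "\<forall>b. b \<notin> insert m S \<longrightarrow> y b = 0" for y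
        proof -
          have "\<forall>b>m. y b = 0" using y insert.hyps by fastforce
          moreover have "m \<notin> lead_set 0 M" using False lead by blast
          ultimately have "y m = 0" using y(1) by (auto simp: lead_set_def)
          then show ?thesis using y by (intro k) auto
        qed
        then show ?thesis using k0 by blast
      qed
    qed
  qed
  from this[OF \<open>finite B\<close>] show ?thesis using supp by blast
qed

text \<open>A Nakayama argument. The case \<open>p = 0\<close> gives \<open>k M \<subseteq> N\<close> for some \<open>k \<noteq> 0\<close>, the prime
case gives \<open>M = N + p M\<close> for every prime \<open>p\<close>; iterating the latter over the prime factors
of \<open>k\<close> gives \<open>M = N + k M = N\<close>.\<close>

lemma submodule_eqI_lead_sets:
  fixes M N :: "('b::linorder \<Rightarrow> int) set"
  assumes "pure_set M" and M: "int_submodule M" and N: "int_submodule N"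
    and "N \<subseteq> M" and "finite B" and supp: "\<And>y b. y \<in> M \<Longrightarrow> b \<notin> B \<Longrightarrow> y b = 0"
    and lead: "\<And>p. zero_or_prime p \<Longrightarrow> lead_set p M \<subseteq> lead_set p N"
  shows "M = N"
proof -
  obtain k where k: "k \<noteq> 0" "\<And>y. y \<in> M \<Longrightarrow> (\<lambda>b. k * y b) \<in> N"
    using common_denominator[of M N B] M N assms(4,5) supp lead[of 0]
    by (auto simp: zero_or_prime_def)
  have "k \<noteq> 0 \<longrightarrow> (\<forall>y\<in>M. \<exists>z\<in>N. \<exists>w\<in>M. \<forall>b. y b = z b + k * w b)"
  proof (induction k rule: prime_divisors_induct)
    case (unit x)
    then have x: "x * x = 1" using int_one_le_iff_zero_less by (auto simp: abs_if split: if_splits)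
    show ?case
    proof (intro impI ballI)
      fix y assume y: "y \<in> M"
      have "(\<lambda>b. x * y b) \<in> M" using int_submoduleD[OF M y y, of x 0] by simp
      moreover have "(\<lambda>_. 0) \<in> N" using N by (simp add: int_submodule_def)
      moreover have "y b = 0 + x * (x * y b)" for b using x by (metis add_0 mult.assoc mult_1)
      ultimately show "\<exists>z\<in>N. \<exists>w\<in>M. \<forall>b. y b = z b + x * w b"
        by (intro bexI[of _ "\<lambda>_. 0"] bexI[of _ "\<lambda>b. x * y b"] allI)
    qed
  next
    case (factor p x)
    show ?case
    proof (intro impI ballI)
      fix y assume y: "y \<in> M" and px: "p * x \<noteq> 0"
      have "\<exists>z\<in>N. \<exists>w\<in>M. \<forall>b. y b = z b + x * w b" using factor y px by simp
      then obtain z w where zw: "z \<in> N" "w \<in> M" "\<And>b. y b = z b + x * w b" by blast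
      have p: "prime p" using factor by simp
      have "\<exists>z\<in>N. \<exists>w'\<in>M. \<forall>b. w b = z b + p * w' b"
        using p lead[of p]
        by (intro reduce_mod_prime[of p M N B w] assms(1-5) zw supp) (auto simp: zero_or_prime_def)
      then obtain z' w' where zw': "z' \<in> N" "w' \<in> M" "\<And>b. w b = z' b + p * w' b" by blast
      have "(\<lambda>b. 1 * z b + x * z' b) \<in> N" using int_submoduleD[OF N zw(1) zw'(1)] .
      moreover have "y b = (1 * z b + x * z' b) + p * x * w' b" for b
        unfolding zw(3) zw'(3) by (simp add: algebra_simps)
      ultimately show "\<exists>z\<in>N. \<exists>w\<in>M. \<forall>b. y b = z b + p * x * w b" using zw'(2)
        by (intro bexI[of _ "\<lambda>b. 1 * z b + x * z' b"] bexI[of _ w'] allI)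
    qed
  qed auto
  then have fin: "\<exists>z\<in>N. \<exists>w\<in>M. \<forall>b. y b = z b + k * w b" if "y \<in> M" for y using k(1) that by blast
  have "y \<in> N" if y: "y \<in> M" for y
  proof -
    obtain z w where zw: "z \<in> N" "w \<in> M" "\<And>b. y b = z b + k * w b"
      using fin[OF y] by blast
    have "(\<lambda>b. 1 * z b + 1 * (k * w b)) \<in> N" using int_submoduleD[OF N zw(1) k(2)[OF zw(2)]] .
    also have "(\<lambda>b. 1 * z b + 1 * (k * w b)) = y" using zw(3) by auto
    finally show ?thesis .
  qed
  then show ?thesis using \<open>N \<subseteq> M\<close> by blast
qed

section \<open>Graded families with a common Hilbert function\<close>

text \<open>An abstract form of the fact that only finitely many monomial ideals have a given Hilbert function,
with \<open>Z e\<close> in the role of the monomials of degree \<open>e\<close>, which \<open>R\<close> relates to their multiples in the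
next degree.

Suppose that no \<open>D\<close> works. As there are finitely many possibilities in each degree, the pigeonhole
principle gives a chain of unbounded subfamilies whose members agree up to higher and higher
degrees, with a limit \<open>U\<close>. The limit is generated up to some degree \<open>D\<close>. A member \<open>Z\<close> that agrees
with \<open>U\<close> up to degree \<open>D\<close> contains \<open>U\<close>, and it equals \<open>U\<close> because both have the
same Hilbert function. So the subfamily of these members is bounded, a contradiction.\<close>

lemma uniform_generation_bound:
  fixes R :: "('b \<times> 'b) set" and \<Z> :: "(nat \<Rightarrow> 'b set) set"
  assumes fin: "\<And>e. finite (B e)"
    and sub: "\<And>Z e. Z \<in> \<Z> \<Longrightarrow> Z e \<subseteq> B e"
    and closed: "\<And>Z e. Z \<in> \<Z> \<Longrightarrow> R `` Z e \<subseteq> Z (Suc e)"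
    and count: "\<And>Z e. Z \<in> \<Z> \<Longrightarrow> card (Z e) = h e"
    and noetherian: "\<And>Z. (\<And>e. Z e \<subseteq> B e) \<Longrightarrow> (\<And>e. R `` Z e \<subseteq> Z (Suc e)) \<Longrightarrow>
        \<exists>D. \<forall>e\<ge>D. Z (Suc e) \<subseteq> R `` Z e"
  shows "\<exists>D. \<forall>Z\<in>\<Z>. \<forall>e\<ge>D. Z (Suc e) \<subseteq> R `` Z e"
proof (rule ccontr)
  define bounded where "bounded \<Y> \<longleftrightarrow> (\<exists>D. \<forall>Z\<in>\<Y>. \<forall>e\<ge>D. Z (Suc e) \<subseteq> R `` Z e)"
    for \<Y> :: "(nat \<Rightarrow> 'b set) set"
  have bounded_UN: "bounded (\<Union>S\<in>\<S>. f S)"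
    if "finite \<S>" "\<And>S. S \<in> \<S> \<Longrightarrow> bounded (f S)"
    for \<S> :: "'b set set" and f
    using that
  proof (induction \<S> rule: finite_induct)
    case empty
    then show ?case by (simp add: bounded_def)
  next
    case (insert S \<S>)
    then obtain D1 D2 where D: "\<forall>Z\<in>f S. \<forall>e\<ge>D1. Z (Suc e) \<subseteq> R `` Z e"
      "\<forall>Z\<in>(\<Union>S\<in>\<S>. f S). \<forall>e\<ge>D2. Z (Suc e) \<subseteq> R `` Z e" unfolding bounded_def by (metis insertCI)
    show ?case unfolding bounded_def
    proof (intro exI[of _ "max D1 D2"] ballI allI impI)
      fix Z e assume "Z \<in> (\<Union>S\<in>insert S \<S>. f S)" and e: "max D1 D2 \<le> e"
      then consider "Z \<in> f S" | "Z \<in> (\<Union>S\<in>\<S>. f S)" by blast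
      then show "Z (Suc e) \<subseteq> R `` Z e"
      proof cases
        case 1
        then show ?thesis using D(1) e by (meson max.boundedE)
      next
        case 2
        then show ?thesis using D(2) e by (meson max.boundedE)
      qed
    qed
  qed
  assume "\<not> ?thesis"
  then have "\<not> bounded \<Z>" by (simp add: bounded_def)
  then have start: "\<exists>\<Y>. \<Y> \<subseteq> \<Z> \<and> \<not> bounded \<Y>" by blast
  have step: "\<exists>\<Y>'. (\<Y>' \<subseteq> \<Z> \<and> \<not> bounded \<Y>') \<and> \<Y>' \<subseteq> \<Y> \<and> (\<exists>S. \<forall>Z\<in>\<Y>'. Z e = S)"
    if "\<Y> \<subseteq> \<Z> \<and> \<not> bounded \<Y>" for \<Y> e
  proof -
    have "\<Y> = (\<Union>S\<in>Pow (B e). {Z\<in>\<Y>. Z e = S})" using sub that by blast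
    then have "\<not> bounded (\<Union>S\<in>Pow (B e). {Z\<in>\<Y>. Z e = S})" using that by metis
    moreover have "bounded (\<Union>S\<in>Pow (B e). {Z\<in>\<Y>. Z e = S})" if "\<And>S. bounded {Z\<in>\<Y>. Z e = S}"
      by (rule bounded_UN) (use fin that in auto)
    ultimately obtain S where S: "\<not> bounded {Z\<in>\<Y>. Z e = S}" by blast
    show ?thesis
    proof (intro exI conjI)
      show "{Z\<in>\<Y>. Z e = S} \<subseteq> \<Z>" using that by blast
      show "\<not> bounded {Z\<in>\<Y>. Z e = S}" by (rule S)
      show "\<forall>Z\<in>{Z\<in>\<Y>. Z e = S}. Z e = S" by blast
    qed blast
  qed
  have "\<exists>\<Y>. \<forall>e. (\<Y> e \<subseteq> \<Z> \<and> \<not> bounded (\<Y> e)) \<and>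
      (\<Y> (Suc e) \<subseteq> \<Y> e \<and> (\<exists>S. \<forall>Z\<in>\<Y> (Suc e). Z e = S))"
    by (rule dependent_nat_choice[of "\<lambda>_ \<Y>. \<Y> \<subseteq> \<Z> \<and> \<not> bounded \<Y>"
        "\<lambda>e \<Y> \<Y>'. \<Y>' \<subseteq> \<Y> \<and> (\<exists>S. \<forall>Z\<in>\<Y>'. Z e = S)"], rule start, rule step)
  then obtain \<Y> where chain: "\<forall>e. (\<Y> e \<subseteq> \<Z> \<and> \<not> bounded (\<Y> e)) \<and>
      (\<Y> (Suc e) \<subseteq> \<Y> e \<and> (\<exists>S. \<forall>Z\<in>\<Y> (Suc e). Z e = S))" by (elim exE)
  have \<Y>: "\<Y> e \<subseteq> \<Z>" "\<not> bounded (\<Y> e)" "\<Y> (Suc e) \<subseteq> \<Y> e" for e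
    using spec[OF chain, of e] by (simp_all only: simp_thms)
  have "\<exists>S. \<forall>Z\<in>\<Y> (Suc e). Z e = S" for e
    using spec[OF chain, of e] by (elim conjE)
  then obtain U where U: "\<And>e Z. Z \<in> \<Y> (Suc e) \<Longrightarrow> Z e = U e" by metis
  have mono: "\<Y> e' \<subseteq> \<Y> e" if "e \<le> e'" for e e' using lift_Suc_antimono_le[of \<Y>, OF \<Y>(3) that] .
  have agree: "Z k = U k" if "Z \<in> \<Y> (Suc e)" "k \<le> e" for Z e k
    using U mono[of "Suc k" "Suc e"] that by auto
  have nonempty: "\<exists>Z. Z \<in> \<Y> e" for e using \<Y>(2)[of e] by (auto simp: bounded_def)
  have Usub: "U e \<subseteq> B e" and Ucard: "card (U e) = h e" and Uclosed: "R `` U e \<subseteq> U (Suc e)" for e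
  proof -
    obtain Z where "Z \<in> \<Y> (Suc (Suc e))" using nonempty by blast
    then have "Z \<in> \<Z>" "Z e = U e" "Z (Suc e) = U (Suc e)" using \<Y>(1) agree[of Z "Suc e"] by auto
    then show "U e \<subseteq> B e" "card (U e) = h e" "R `` U e \<subseteq> U (Suc e)"
      using sub[of Z e] count[of Z e] closed[of Z e] by auto
  qed
  obtain D where D: "\<And>e. e \<ge> D \<Longrightarrow> U (Suc e) \<subseteq> R `` U e" using noetherian[of U] Usub Uclosed by blast
  \<comment> \<open>Agreement up to the degree where \<open>U\<close> is generated gives \<open>U \<subseteq> Z\<close>; equal finite
    cardinalities in each degree then give equality.\<close>
  have ZU: "Z e = U e" if Z: "Z \<in> \<Y> (Suc D)" for Z e
  proof (cases "e \<le> D")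
    case True
    then show ?thesis using agree Z by blast
  next
    case False
    have Z': "Z \<in> \<Z>" using Z \<Y>(1) by blast
    have "U (D + k) \<subseteq> Z (D + k)" for k
    proof (induction k)
      case 0
      then show ?case using agree[OF Z, of D] by simp
    next
      case (Suc k)
      have "U (Suc (D + k)) \<subseteq> R `` U (D + k)" by (rule D) simp
      also have "\<dots> \<subseteq> R `` Z (D + k)" using Suc by blast
      also have "\<dots> \<subseteq> Z (Suc (D + k))" using closed Z' by blast
      finally show ?case by simp
    qed
    from this[of "e - D"] have "U e \<subseteq> Z e" using False by simp
    moreover have "finite (Z e)" using sub[OF Z'] fin by (rule finite_subset)
    moreover have "card (U e) = card (Z e)" using Ucard count[OF Z'] by simp
    ultimately show ?thesis using card_subset_eq by metis
  qed
  have "bounded (\<Y> (Suc D))" unfolding bounded_def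
  proof (intro exI ballI allI impI)
    fix Z e assume "Z \<in> \<Y> (Suc D)" "D \<le> e"
    then show "Z (Suc e) \<subseteq> R `` Z e" using D ZU by metis
  qed
  then show False using \<Y>(2) by blast
qed

section \<open>Dickson's lemma for shifted monomials\<close>

lemma ex_nondecreasing_subsequence:
  fixes s :: "nat \<Rightarrow> nat"
  obtains r where "strict_mono (r :: nat \<Rightarrow> nat)" "mono (\<lambda>j. s (r j))"
proof -
  obtain r where r: "strict_mono (r :: nat \<Rightarrow> nat)" "monoseq (\<lambda>j. s (r j))" using seq_monosub[of s] by blast
  from r(2) consider "\<forall>i j. i \<le> j \<longrightarrow> s (r i) \<le> s (r j)" | "\<forall>i j. i \<le> j \<longrightarrow> s (r j) \<le> s (r i)"
    by (auto simp: monoseq_def)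
  then show ?thesis
  proof cases
    case 1
    then show ?thesis using r(1) by (intro that[of r]) (auto simp: mono_def)
  next
    case 2
    \<comment> \<open>A nonincreasing sequence of natural numbers is constant from its minimum on.\<close>
    obtain k where k: "\<And>j. s (r k) \<le> s (r j)"
      using ex_has_least_nat[of "\<lambda>_. True" 0 "\<lambda>j. s (r j)"] by auto
    then have "s (r (k + j)) = s (r k)" for j using 2 by (meson le_add1 le_antisym)
    then show ?thesis using r(1)
      by (intro that[of "\<lambda>j. r (k + j)"]) (auto simp: mono_def strict_mono_def)
  qed
qed

lemma simultaneous_nondecreasing_subsequence:
  fixes s :: "nat \<Rightarrow> 'k \<Rightarrow> nat"
  assumes "finite I"
  shows "\<exists>r. strict_mono (r :: nat \<Rightarrow> nat) \<and> (\<forall>i\<in>I. mono (\<lambda>j. s (r j) i))"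
  using assms
proof (induction I rule: finite_induct)
  case empty
  show ?case by (intro exI[of _ id]) (auto simp: strict_mono_def)
next
  case (insert i I)
  then obtain r where r: "strict_mono (r :: nat \<Rightarrow> nat)" "\<forall>i\<in>I. mono (\<lambda>j. s (r j) i)" by blast
  obtain r' where r': "strict_mono (r' :: nat \<Rightarrow> nat)" "mono (\<lambda>j. s (r (r' j)) i)"
    using ex_nondecreasing_subsequence[of "\<lambda>j. s (r j) i"] by blast
  have "mono (\<lambda>j. s (r (r' j)) i')" if "i' \<in> I" for i'
    using r(2) that r'(1) by (meson mono_def strict_mono_less_eq)
  moreover have "strict_mono (\<lambda>j. r (r' j))" using r(1) r'(1) by (simp add: strict_mono_def)
  ultimately show ?case using r'(2) by (intro exI[of _ "\<lambda>j. r (r' j)"]) auto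
qed

type_synonym monomial = "nat \<Rightarrow>\<^sub>0 nat"

text \<open>Only the first \<open>N\<close> exponents are counted. On monomials in these indeterminates this is the total
degree, and as a sum over a fixed index set it is additive without side conditions.\<close>

definition mon_degree :: "nat \<Rightarrow> monomial \<Rightarrow> nat" where
  "mon_degree N \<alpha> = (\<Sum>v<N. Poly_Mapping.lookup \<alpha> v)"

definition monomials_upto :: "nat \<Rightarrow> nat \<Rightarrow> monomial set" where
  "monomials_upto N e = {\<alpha>. Poly_Mapping.keys \<alpha> \<subseteq> {..<N} \<and> mon_degree N \<alpha> \<le> e}"

abbreviation mon_var :: "nat \<Rightarrow> monomial" where
  "mon_var v \<equiv> Poly_Mapping.single v (Suc 0)"

lemma mon_degree_add: "mon_degree N (\<alpha> + \<beta>) = mon_degree N \<alpha> + mon_degree N \<beta>"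
  by (simp add: mon_degree_def lookup_add sum.distrib)

lemma mon_degree_var [simp]: "v < N \<Longrightarrow> mon_degree N (mon_var v) = 1"
  by (simp add: mon_degree_def lookup_single when_def)

lemma finite_monomials_upto [simp]: "finite (monomials_upto N e)"
proof -
  let ?f = "\<lambda>\<alpha>. restrict (Poly_Mapping.lookup \<alpha>) {..<N}"
  have "?f ` monomials_upto N e \<subseteq> {..<N} \<rightarrow>\<^sub>E {..e}"
  proof (clarsimp simp: monomials_upto_def mon_degree_def)
    fix \<alpha> :: monomial and v assume "(\<Sum>v<N. Poly_Mapping.lookup \<alpha> v) \<le> e" "v < N"
    then show "Poly_Mapping.lookup \<alpha> v \<le> e"
      using member_le_sum[of v "{..<N}" "Poly_Mapping.lookup \<alpha>"] by simp
  qed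
  then have "finite (?f ` monomials_upto N e)" by (rule finite_subset) (simp add: finite_PiE)
  moreover have "inj_on ?f (monomials_upto N e)"
  proof (rule inj_onI, rule poly_mapping_eqI)
    fix \<alpha> \<beta> v assume "\<alpha> \<in> monomials_upto N e" "\<beta> \<in> monomials_upto N e" and eq: "?f \<alpha> = ?f \<beta>"
    then have "v \<notin> Poly_Mapping.keys \<alpha> \<and> v \<notin> Poly_Mapping.keys \<beta>" if "\<not> v < N"
      using that by (auto simp: monomials_upto_def)
    then show "Poly_Mapping.lookup \<alpha> v = Poly_Mapping.lookup \<beta> v"
      using fun_cong[OF eq, of v] by (cases "v < N") (auto simp: in_keys_iff)
  qed
  ultimately show ?thesis by (rule finite_imageD)
qed

lemma monomials_upto_mono: "e \<le> e' \<Longrightarrow> monomials_upto N e \<subseteq> monomials_upto N e'"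
  by (auto simp: monomials_upto_def)

text \<open>The pair \<open>(i, \<alpha>)\<close> stands for the monomial \<open>\<alpha>\<close> in the \<open>i\<close>-th entry of a vector. The passage from
degree \<open>e\<close> to degree \<open>e + 1\<close> multiplies by an indeterminate or does nothing. The identity
plays the role of the homogenizing indeterminate: a pair in degree \<open>e\<close> is homogenized
to total degree \<open>e\<close>, and no polynomial ever has to be homogenized.\<close>

definition shift_rel :: "nat \<Rightarrow> ((nat \<times> monomial) \<times> (nat \<times> monomial)) set" where
  "shift_rel N = Id \<union> {((i, \<alpha>), (i, \<alpha> + mon_var v)) | i \<alpha> v. v < N}"

lemma divisible_monomial_cases:
  fixes \<alpha> \<beta> :: monomial
  assumes "\<alpha> \<noteq> \<beta>" "Poly_Mapping.keys \<alpha> \<subseteq> {..<N}" "Poly_Mapping.keys \<beta> \<subseteq> {..<N}"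
    and le: "\<And>v. v < N \<Longrightarrow> Poly_Mapping.lookup \<alpha> v \<le> Poly_Mapping.lookup \<beta> v"
  obtains v \<gamma> where "v < N" "\<beta> = \<gamma> + mon_var v" "Poly_Mapping.keys \<gamma> \<subseteq> {..<N}"
    "\<And>v. v < N \<Longrightarrow> Poly_Mapping.lookup \<alpha> v \<le> Poly_Mapping.lookup \<gamma> v"
proof -
  have "\<exists>v<N. Poly_Mapping.lookup \<alpha> v \<noteq> Poly_Mapping.lookup \<beta> v"
  proof (rule ccontr)
    assume neg: "\<not> ?thesis"
    have "\<alpha> = \<beta>"
    proof (rule poly_mapping_eqI)
      fix v
      show "Poly_Mapping.lookup \<alpha> v = Poly_Mapping.lookup \<beta> v"
      proof (cases "v < N")
        case False
        then have "v \<notin> Poly_Mapping.keys \<alpha>" "v \<notin> Poly_Mapping.keys \<beta>" using assms by auto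
        then show ?thesis by (simp add: in_keys_iff)
      qed (use neg in auto)
    qed
    then show False using assms by blast
  qed
  then obtain v where v: "v < N" "Poly_Mapping.lookup \<alpha> v < Poly_Mapping.lookup \<beta> v"
    using le by (meson le_neq_implies_less)
  define \<gamma> where "\<gamma> = \<beta> - mon_var v"
  have look: "Poly_Mapping.lookup \<gamma> u = Poly_Mapping.lookup \<beta> u - (if u = v then 1 else 0)" for u
    by (auto simp: \<gamma>_def lookup_minus lookup_single when_def)
  have "\<beta> = \<gamma> + mon_var v"
    by (rule poly_mapping_eqI) (use v in \<open>auto simp: lookup_add lookup_single when_def look\<close>)
  moreover have "Poly_Mapping.keys \<gamma> \<subseteq> {..<N}"
  proof
    fix u assume "u \<in> Poly_Mapping.keys \<gamma>"
    then have "u \<in> Poly_Mapping.keys \<beta>" by (auto simp: in_keys_iff look split: if_splits)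
    then show "u \<in> {..<N}" using assms by blast
  qed
  ultimately show ?thesis using v le by (intro that[of v \<gamma>]) (auto simp: look)
qed

lemma reach_by_shifts:
  assumes closed: "\<And>e. shift_rel N `` Z e \<subseteq> Z (Suc e)"
    and "(i, \<alpha>) \<in> Z e" "Poly_Mapping.keys \<alpha> \<subseteq> {..<N}" "Poly_Mapping.keys \<beta> \<subseteq> {..<N}"
    and le: "\<And>v. v < N \<Longrightarrow> Poly_Mapping.lookup \<alpha> v \<le> Poly_Mapping.lookup \<beta> v"
    and "e + mon_degree N \<beta> \<le> e' + mon_degree N \<alpha>"
  shows "(i, \<beta>) \<in> Z e'"
  using assms(4-6)
proof (induction "mon_degree N \<beta>" arbitrary: \<beta> e')
  case 0
  have stay: "(i, \<alpha>) \<in> Z (e + k)" for k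
    by (induction k) (use assms(2) closed in \<open>auto simp: shift_rel_def\<close>)
  show ?case
  proof (cases "\<alpha> = \<beta>")
    case True
    then show ?thesis using stay[of "e' - e"] 0 by simp
  next
    case False
    then obtain v \<gamma> where "v < N" "\<beta> = \<gamma> + mon_var v"
      using divisible_monomial_cases[OF False assms(3) 0(2,3)] by blast
    then show ?thesis using 0(1) by (simp add: mon_degree_add)
  qed
next
  case (Suc d)
  have stay: "(i, \<alpha>) \<in> Z (e + k)" for k
    by (induction k) (use assms(2) closed in \<open>auto simp: shift_rel_def\<close>)
  show ?case
  proof (cases "\<alpha> = \<beta>")
    case True
    then show ?thesis using stay[of "e' - e"] Suc.prems by simp
  next
    case False
    then obtain v \<gamma> where *: "v < N" "\<beta> = \<gamma> + mon_var v" "Poly_Mapping.keys \<gamma> \<subseteq> {..<N}"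
      "\<And>v. v < N \<Longrightarrow> Poly_Mapping.lookup \<alpha> v \<le> Poly_Mapping.lookup \<gamma> v"
      using divisible_monomial_cases[OF False assms(3) Suc.prems(1,2)] by blast
    have deg: "mon_degree N \<gamma> = d" using Suc(2) * by (simp add: mon_degree_add)
    have "mon_degree N \<alpha> \<le> mon_degree N \<gamma>" unfolding mon_degree_def by (rule sum_mono) (use * in auto)
    then have e': "e' > 0" using Suc.prems(3) Suc(2) deg by simp
    have "(i, \<gamma>) \<in> Z (e' - 1)" by (rule Suc(1)) (use * deg Suc.prems(3) Suc(2) e' in auto)
    moreover have "((i, \<gamma>), (i, \<beta>)) \<in> shift_rel N" using * by (auto simp: shift_rel_def)
    ultimately have "(i, \<beta>) \<in> Z (Suc (e' - 1))" using closed by blast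
    then show ?thesis using e' by simp
  qed
qed

text \<open>Dickson's lemma for homogenized monomials: a sequence of new elements in increasing degrees has
two members of which the earlier divides the later, so that the later one is not new. The shift
\<open>d\<close> in the degree is needed because the image of a syzygy candidate of degree \<open>e\<close> under a row of
polynomials of degree \<open>d\<close> has degree up to \<open>e + d\<close>.\<close>

lemma shift_closed_finitely_generated:
  fixes Z :: "nat \<Rightarrow> (nat \<times> monomial) set"
  assumes sub: "\<And>e. Z e \<subseteq> {..n} \<times> monomials_upto N (e + d)"
    and closed: "\<And>e. shift_rel N `` Z e \<subseteq> Z (Suc e)"
  shows "\<exists>D. \<forall>e\<ge>D. Z (Suc e) \<subseteq> shift_rel N `` Z e"
proof (rule ccontr)
  assume "\<not> ?thesis"
  then have "\<forall>D. \<exists>e\<ge>D. \<exists>b. b \<in> Z (Suc e) \<and> b \<notin> shift_rel N `` Z e" by blast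
  then have "\<exists>\<epsilon> \<b>. \<forall>D. \<epsilon> D \<ge> D \<and> \<b> D \<in> Z (Suc (\<epsilon> D)) \<and> \<b> D \<notin> shift_rel N `` Z (\<epsilon> D)" by metis
  then obtain \<epsilon> :: "nat \<Rightarrow> nat" and \<b>
    where new: "\<And>D. \<epsilon> D \<ge> D" "\<And>D. \<b> D \<in> Z (Suc (\<epsilon> D))" "\<And>D. \<b> D \<notin> shift_rel N `` Z (\<epsilon> D)"
    by blast
  \<comment> \<open>The coordinates to be made nondecreasing: the \<open>N\<close> exponents, the slack in the degree, and
    the index \<open>i\<close> and its complement \<open>n - i\<close>, which together make \<open>i\<close> constant.\<close>
  define s where "s j k = (if k < N then Poly_Mapping.lookup (snd (\<b> j)) k
      else if k = N then \<epsilon> j + Suc d - mon_degree N (snd (\<b> j))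
      else if k = N + 1 then fst (\<b> j) else n - fst (\<b> j))" for j k
  obtain r where r: "strict_mono (r :: nat \<Rightarrow> nat)" "\<And>k. k < N + 3 \<Longrightarrow> mono (\<lambda>j. s (r j) k)"
    using simultaneous_nondecreasing_subsequence[of "{..<N + 3}" s] by auto
  define j where "j = r 0"
  define l where "l = r (Suc (\<epsilon> j))"
  have "\<epsilon> j < l" unfolding l_def using strict_mono_imp_increasing[OF r(1), of "Suc (\<epsilon> j)"] by simp
  then have e_less: "\<epsilon> j < \<epsilon> l" using new(1)[of l] by simp
  have s_le: "s j k \<le> s l k" if "k < N + 3" for k
    using r(2)[OF that] by (simp add: j_def l_def mono_def)
  obtain i \<alpha> where j: "\<b> j = (i, \<alpha>)" by fastforce
  obtain i' \<beta> where l: "\<b> l = (i', \<beta>)" by fastforce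
  have \<alpha>: "i \<le> n" "Poly_Mapping.keys \<alpha> \<subseteq> {..<N}" "mon_degree N \<alpha> \<le> Suc (\<epsilon> j) + d"
    using subsetD[OF sub new(2)[of j]] by (auto simp: j monomials_upto_def)
  have \<beta>: "i' \<le> n" "Poly_Mapping.keys \<beta> \<subseteq> {..<N}" "mon_degree N \<beta> \<le> Suc (\<epsilon> l) + d"
    using subsetD[OF sub new(2)[of l]] by (auto simp: l monomials_upto_def)
  have ii: "i' = i" using s_le[of "N + 1"] s_le[of "N + 2"] \<alpha>(1) \<beta>(1) by (simp add: s_def j l)
  have le: "Poly_Mapping.lookup \<alpha> v \<le> Poly_Mapping.lookup \<beta> v" if "v < N" for v
    using s_le[of v] that by (simp add: s_def j l)
  have slack: "Suc (\<epsilon> j) + mon_degree N \<beta> \<le> Suc (\<epsilon> l) + mon_degree N \<alpha>"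
    using s_le[of N] \<alpha>(3) \<beta>(3) by (simp add: s_def j l)
  have start: "(i, \<alpha>) \<in> Z (Suc (\<epsilon> j))" using new(2)[of j] j by simp
  have "\<b> l \<in> shift_rel N `` Z (\<epsilon> l)"
  proof (cases "\<alpha> = \<beta>")
    case True
    have "(i, \<beta>) \<in> Z (\<epsilon> l)"
      by (rule reach_by_shifts[of N Z, OF closed start \<alpha>(2) \<beta>(2) le]) (use e_less True in auto)
    then show ?thesis by (auto simp: l ii shift_rel_def)
  next
    case False
    then obtain v \<gamma> where *: "v < N" "\<beta> = \<gamma> + mon_var v" "Poly_Mapping.keys \<gamma> \<subseteq> {..<N}"
      "\<And>v. v < N \<Longrightarrow> Poly_Mapping.lookup \<alpha> v \<le> Poly_Mapping.lookup \<gamma> v"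
      using divisible_monomial_cases[OF False \<alpha>(2) \<beta>(2) le] by blast
    have "(i, \<gamma>) \<in> Z (\<epsilon> l)"
      by (rule reach_by_shifts[of N Z, OF closed start \<alpha>(2) *(3,4)])
        (use slack * in \<open>auto simp: mon_degree_add\<close>)
    then show ?thesis using * by (auto simp: l ii shift_rel_def)
  qed
  then show False using new(3) by blast
qed

section \<open>Syzygies of bounded degree\<close>

lemma single_times_eq_sum:
  fixes q :: "'v int_mpoly"
  shows "Poly_Mapping.single s k * q =
    (\<Sum>m\<in>Poly_Mapping.keys q. Poly_Mapping.single (s + m) (k * Poly_Mapping.lookup q m))"
  by (subst int_mpoly_sum_monomials[of q]) (simp add: sum_distrib_left mult_single)

lemma lookup_single_times_add [simp]:
  fixes q :: "'v int_mpoly"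
  shows "Poly_Mapping.lookup (Poly_Mapping.single s k * q) (s + \<alpha>) = k * Poly_Mapping.lookup q \<alpha>"
  unfolding single_times_eq_sum lookup_sum
  by (auto simp: lookup_single when_def in_keys_iff)

lemma lookup_single_times_not_divisible:
  fixes q :: "'v int_mpoly"
  assumes "\<And>\<alpha>. \<gamma> \<noteq> s + \<alpha>"
  shows "Poly_Mapping.lookup (Poly_Mapping.single s k * q) \<gamma> = 0"
  unfolding single_times_eq_sum lookup_sum
  by (rule sum.neutral) (use assms in \<open>auto simp: lookup_single when_def\<close>)

lemma lookup_of_int_times [simp]:
  fixes q :: "'v int_mpoly"
  shows "Poly_Mapping.lookup (of_int k * q) \<alpha> = k * Poly_Mapping.lookup q \<alpha>"
  using lookup_single_times_add[of 0 "of_int k" q \<alpha>] unfolding single_of_int by simp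

text \<open>Vectors are extended by \<open>0\<close> beyond their length \<open>n\<close>, so that sums and multiples are formed
pointwise.\<close>

definition vectors_upto :: "nat \<Rightarrow> nat \<Rightarrow> nat \<Rightarrow> (nat \<Rightarrow> nat int_mpoly) set" where
  "vectors_upto N n e =
     {y. (\<forall>i<n. Poly_Mapping.keys (y i) \<subseteq> monomials_upto N e) \<and> (\<forall>i\<ge>n. y i = 0)}"

definition row_apply :: "nat \<Rightarrow> (nat \<Rightarrow> nat int_mpoly) \<Rightarrow> (nat \<Rightarrow> nat int_mpoly) \<Rightarrow> nat int_mpoly" where
  "row_apply n g y = (\<Sum>i<n. g i * y i)"

definition syzygies_upto :: "nat \<Rightarrow> nat \<Rightarrow> (nat \<Rightarrow> nat int_mpoly) \<Rightarrow> nat \<Rightarrow> (nat \<Rightarrow> nat int_mpoly) set"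
  where "syzygies_upto N n g e = {y \<in> vectors_upto N n e. row_apply n g y = 0}"

definition coords :: "(nat \<Rightarrow> nat int_mpoly) \<Rightarrow> nat \<times> monomial \<Rightarrow> int" where
  "coords y = (\<lambda>(i, \<alpha>). Poly_Mapping.lookup (y i) \<alpha>)"

text \<open>The matrix, in the bases of monomials, of the linear map that a row of polynomials induces on
vectors of bounded degree.\<close>

definition macaulay :: "(nat \<Rightarrow> nat int_mpoly) \<Rightarrow> monomial \<Rightarrow> nat \<times> monomial \<Rightarrow> int" where
  "macaulay g \<gamma> = (\<lambda>(i, \<alpha>). Poly_Mapping.lookup (g i * Poly_Mapping.single \<alpha> 1) \<gamma>)"

abbreviation positions :: "nat \<Rightarrow> nat \<Rightarrow> nat \<Rightarrow> (nat \<times> monomial) set" where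
  "positions N n e \<equiv> {..<n} \<times> monomials_upto N e"

lemma inj_coords: "coords y = coords z \<Longrightarrow> y = z"
  by (rule ext, rule poly_mapping_eqI) (auto simp: coords_def fun_eq_iff)

lemma coords_vectors_upto: "coords ` vectors_upto N n e = supported (positions N n e)"
proof (rule set_eqI, rule iffI)
  fix u assume "u \<in> coords ` vectors_upto N n e"
  then obtain y where y: "y \<in> vectors_upto N n e" "u = coords y" by blast
  have "Poly_Mapping.lookup (y i) \<alpha> = 0" if "\<not> (i < n \<and> \<alpha> \<in> monomials_upto N e)" for i \<alpha>
    using y(1) that by (cases "i < n") (auto simp: vectors_upto_def in_keys_iff subset_iff)
  then show "u \<in> supported (positions N n e)" by (auto simp: y(2) coords_def supported_def)
next
  fix u assume u: "u \<in> supported (positions N n e)"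
  define y :: "nat \<Rightarrow> nat int_mpoly"
    where "y i = (\<Sum>\<alpha>\<in>monomials_upto N e. Poly_Mapping.single \<alpha> (u (i, \<alpha>)))" for i
  have look: "Poly_Mapping.lookup (y i) \<alpha> = u (i, \<alpha>)" for i \<alpha>
    using u by (auto simp: y_def lookup_sum lookup_single when_def supported_def)
  have "y \<in> vectors_upto N n e"
    unfolding vectors_upto_def
  proof (intro CollectI conjI allI impI subsetI)
    fix i \<alpha> assume "\<alpha> \<in> Poly_Mapping.keys (y i)"
    then show "\<alpha> \<in> monomials_upto N e" using u by (auto simp: in_keys_iff look supported_def)
  next
    fix i assume "n \<le> i"
    then show "y i = 0" using u by (intro poly_mapping_eqI) (auto simp: look supported_def)
  qed
  moreover have "coords y = u" by (auto simp: coords_def look)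
  ultimately show "u \<in> coords ` vectors_upto N n e" by blast
qed

lemma keys_times_monomials_upto:
  fixes p q :: "nat int_mpoly"
  assumes "Poly_Mapping.keys p \<subseteq> monomials_upto N d" "Poly_Mapping.keys q \<subseteq> monomials_upto N e"
  shows "Poly_Mapping.keys (p * q) \<subseteq> monomials_upto N (e + d)"
proof
  fix \<gamma> assume "\<gamma> \<in> Poly_Mapping.keys (p * q)"
  then obtain \<alpha> \<beta> where "\<gamma> = \<alpha> + \<beta>" "\<alpha> \<in> Poly_Mapping.keys p" "\<beta> \<in> Poly_Mapping.keys q"
    using keys_mult[of p q] by blast
  then show "\<gamma> \<in> monomials_upto N (e + d)"
    using assms keys_add[of \<alpha> \<beta>] by (fastforce simp: monomials_upto_def mon_degree_add)
qed

lemma matrix_map_macaulay: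
  assumes g: "\<forall>i<n. Poly_Mapping.keys (g i) \<subseteq> monomials_upto N d"
    and y: "y \<in> vectors_upto N n e"
  shows "matrix_map (positions N n e) (monomials_upto N (e + d)) (macaulay g) (coords y) =
    Poly_Mapping.lookup (row_apply n g y)"
proof
  fix \<gamma>
  show "matrix_map (positions N n e) (monomials_upto N (e + d)) (macaulay g) (coords y) \<gamma> =
    Poly_Mapping.lookup (row_apply n g y) \<gamma>"
  proof (cases "\<gamma> \<in> monomials_upto N (e + d)")
    case True
    have "g i * y i = (\<Sum>\<alpha>\<in>monomials_upto N e. of_int (Poly_Mapping.lookup (y i) \<alpha>) *
        (g i * Poly_Mapping.single \<alpha> 1))" if "i < n" for i
    proof -
      have "y i = (\<Sum>\<alpha>\<in>Poly_Mapping.keys (y i). Poly_Mapping.single \<alpha> (Poly_Mapping.lookup (y i) \<alpha>))"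
        by (rule int_mpoly_sum_monomials)
      also have "\<dots> = (\<Sum>\<alpha>\<in>monomials_upto N e. Poly_Mapping.single \<alpha> (Poly_Mapping.lookup (y i) \<alpha>))"
        by (rule sum.mono_neutral_left) (use y that in \<open>auto simp: vectors_upto_def in_keys_iff\<close>)
      also have "\<dots> = (\<Sum>\<alpha>\<in>monomials_upto N e.
          of_int (Poly_Mapping.lookup (y i) \<alpha>) * Poly_Mapping.single \<alpha> 1)"
        by (simp add: mult_single flip: single_of_int)
      finally have "g i * y i = g i * \<dots>" by (rule arg_cong)
      then show ?thesis by (simp add: sum_distrib_left mult_ac)
    qed
    then have "row_apply n g y = (\<Sum>i<n. \<Sum>\<alpha>\<in>monomials_upto N e.
        of_int (Poly_Mapping.lookup (y i) \<alpha>) * (g i * Poly_Mapping.single \<alpha> 1))"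
      by (simp add: row_apply_def)
    then have "Poly_Mapping.lookup (row_apply n g y) \<gamma> =
        (\<Sum>i<n. \<Sum>\<alpha>\<in>monomials_upto N e. macaulay g \<gamma> (i, \<alpha>) * coords y (i, \<alpha>))"
      by (simp add: lookup_sum macaulay_def coords_def mult.commute)
    then show ?thesis using True by (simp add: matrix_map_def sum.cartesian_product)
  next
    case False
    have "Poly_Mapping.keys (g i * y i) \<subseteq> monomials_upto N (e + d)" if "i < n" for i
      by (rule keys_times_monomials_upto) (use g y that in \<open>auto simp: vectors_upto_def\<close>)
    then have "Poly_Mapping.lookup (g i * y i) \<gamma> = 0" if "i < n" for i
      using False that by (meson in_keys_iff subsetD)
    then show ?thesis using False by (simp add: matrix_map_def row_apply_def lookup_sum)
  qed
qed

lemma coords_syzygies_upto: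
  assumes "\<forall>i<n. Poly_Mapping.keys (g i) \<subseteq> monomials_upto N d"
  shows "coords ` syzygies_upto N n g e =
    matrix_kernel (positions N n e) (monomials_upto N (e + d)) (macaulay g)"
proof -
  have "row_apply n g y = 0 \<longleftrightarrow>
      matrix_map (positions N n e) (monomials_upto N (e + d)) (macaulay g) (coords y) = (\<lambda>_. 0)"
    if "y \<in> vectors_upto N n e" for y
    unfolding matrix_map_macaulay[OF assms that] by (auto simp: poly_mapping_eq_iff fun_eq_iff)
  then show ?thesis
    unfolding matrix_kernel_def syzygies_upto_def coords_vectors_upto[symmetric] by auto
qed

text \<open>The leading positions of the syzygies modulo \<open>p\<close>, together with the leading monomials of the
values of the row over the rationals, have a Hilbert function that depends neither on the row nor
on \<open>p\<close>.\<close>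

lemma card_lead_sets:
  assumes "zero_or_prime p" "\<forall>i<n. Poly_Mapping.keys (g i) \<subseteq> monomials_upto N d"
  shows "card (lead_set p (coords ` syzygies_upto N n g e)) +
      card (lead_set 0 ((\<lambda>y. Poly_Mapping.lookup (row_apply n g y)) ` vectors_upto N n e)) =
    card (positions N n e)"
proof -
  have "(\<lambda>y. Poly_Mapping.lookup (row_apply n g y)) ` vectors_upto N n e =
      matrix_map (positions N n e) (monomials_upto N (e + d)) (macaulay g) ` coords ` vectors_upto N n e"
    using matrix_map_macaulay[OF assms(2)] by (auto simp: image_image)
  then show ?thesis
    using rank_nullity_lead_sets[OF assms(1), of "positions N n e" "monomials_upto N (e + d)" "macaulay g"]
    unfolding coords_syzygies_upto[OF assms(2)] coords_vectors_upto by simp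
qed

lemma lead_set_transport:
  assumes "strict_mono \<sigma>"
    and "\<And>y. y \<in> M \<Longrightarrow> \<exists>y'\<in>M'. (\<forall>b. y' (\<sigma> b) = y b) \<and> (\<forall>b. b \<notin> range \<sigma> \<longrightarrow> y' b = 0)"
    and "b \<in> lead_set p M"
  shows "\<sigma> b \<in> lead_set p M'"
proof -
  obtain y where y: "y \<in> M" "\<not> p dvd y b" "\<forall>b'>b. p dvd y b'" using assms(3) by (auto simp: lead_set_def)
  obtain y' where y': "y' \<in> M'" "\<And>b. y' (\<sigma> b) = y b" "\<And>b. b \<notin> range \<sigma> \<Longrightarrow> y' b = 0"
    using assms(2)[OF y(1)] by blast
  have up: "p dvd y' b'" if "\<sigma> b < b'" for b'
  proof (cases "b' \<in> range \<sigma>")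
    case True
    then obtain a where a: "b' = \<sigma> a" by blast
    then have "b < a" using that assms(1) by (simp add: strict_mono_less)
    then show ?thesis using y y' a by simp
  qed (simp add: y')
  have "\<not> p dvd y' (\<sigma> b)" using y y' by simp
  then show ?thesis unfolding lead_set_def using y'(1) up by blast
qed

definition mon_shift :: "nat \<Rightarrow> nat \<times> monomial \<Rightarrow> nat \<times> monomial" where
  "mon_shift v = (\<lambda>(i, \<alpha>). (i, \<alpha> + mon_var v))"

lemma strict_mono_mon_shift: "strict_mono (mon_shift v)"
  by (auto simp: strict_mono_def mon_shift_def)

lemma lookup_mvar_times:
  "Poly_Mapping.lookup (mvar v * q) (\<alpha> + mon_var v) = Poly_Mapping.lookup q \<alpha>"
  "\<gamma> \<notin> range (\<lambda>\<alpha>. \<alpha> + mon_var v) \<Longrightarrow> Poly_Mapping.lookup (mvar v * q) \<gamma> = 0"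
proof -
  show "Poly_Mapping.lookup (mvar v * q) (\<alpha> + mon_var v) = Poly_Mapping.lookup q \<alpha>"
    using lookup_single_times_add[of "mon_var v" 1 q \<alpha>] by (simp add: mvar_def add.commute)
  show "Poly_Mapping.lookup (mvar v * q) \<gamma> = 0" if "\<gamma> \<notin> range (\<lambda>\<alpha>. \<alpha> + mon_var v)"
    unfolding mvar_def using that
    by (intro lookup_single_times_not_divisible) (auto simp: add.commute)
qed

lemma coords_mvar_times:
  "coords (\<lambda>i. mvar v * y i) (mon_shift v b) = coords y b"
  "b \<notin> range (mon_shift v) \<Longrightarrow> coords (\<lambda>i. mvar v * y i) b = 0"
proof -
  show "coords (\<lambda>i. mvar v * y i) (mon_shift v b) = coords y b"
    by (cases b) (simp add: coords_def mon_shift_def lookup_mvar_times)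
  assume b: "b \<notin> range (mon_shift v)"
  obtain i \<gamma> where i: "b = (i, \<gamma>)" by fastforce
  have "\<gamma> \<notin> range (\<lambda>\<alpha>. \<alpha> + mon_var v)"
  proof
    assume "\<gamma> \<in> range (\<lambda>\<alpha>. \<alpha> + mon_var v)"
    then obtain \<alpha> where "\<gamma> = \<alpha> + mon_var v" by blast
    then have "b = mon_shift v (i, \<alpha>)" by (simp add: i mon_shift_def)
    then show False using b by blast
  qed
  then show "coords (\<lambda>i. mvar v * y i) b = 0" by (simp add: i coords_def lookup_mvar_times)
qed

lemma lead_set_mon_shift:
  assumes "\<And>y. y \<in> Y \<Longrightarrow> (\<lambda>i. mvar v * y i) \<in> Y'" "b \<in> lead_set p (coords ` Y)"
  shows "mon_shift v b \<in> lead_set p (coords ` Y')"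
proof (rule lead_set_transport[OF strict_mono_mon_shift _ assms(2)])
  fix u assume "u \<in> coords ` Y"
  then obtain y where y: "y \<in> Y" "u = coords y" by blast
  then show "\<exists>u'\<in>coords ` Y'. (\<forall>b. u' (mon_shift v b) = u b) \<and> (\<forall>b. b \<notin> range (mon_shift v) \<longrightarrow> u' b = 0)"
    using assms(1)[OF y(1)]
    by (intro bexI[of _ "coords (\<lambda>i. mvar v * y i)"] conjI allI impI)
      (simp_all add: coords_mvar_times)
qed

lemma vectors_upto_mono: "e \<le> e' \<Longrightarrow> vectors_upto N n e \<subseteq> vectors_upto N n e'"
  unfolding vectors_upto_def using monomials_upto_mono by blast

lemma mvar_times_vectors_upto:
  assumes "y \<in> vectors_upto N n e" "v < N"
  shows "(\<lambda>i. mvar v * y i) \<in> vectors_upto N n (Suc e)"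
proof -
  have "Poly_Mapping.keys (mvar v * y i) \<subseteq> monomials_upto N (e + 1)" if "i < n" for i
  proof (rule keys_times_monomials_upto)
    show "Poly_Mapping.keys (mvar v) \<subseteq> monomials_upto N 1"
      using assms(2) by (auto simp: mvar_def monomials_upto_def)
    show "Poly_Mapping.keys (y i) \<subseteq> monomials_upto N e" using assms that by (simp add: vectors_upto_def)
  qed
  then show ?thesis using assms by (auto simp: vectors_upto_def)
qed

lemma row_apply_mvar_times: "row_apply n g (\<lambda>i. mvar v * y i) = mvar v * row_apply n g y"
  by (simp add: row_apply_def sum_distrib_left mult_ac)

lemma mvar_times_syzygies_upto:
  assumes "y \<in> syzygies_upto N n g e" "v < N"
  shows "(\<lambda>i. mvar v * y i) \<in> syzygies_upto N n g (Suc e)"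
  using assms mvar_times_vectors_upto[of y N n e v] by (simp add: syzygies_upto_def row_apply_mvar_times)

lemma syzygies_upto_mono: "e \<le> e' \<Longrightarrow> syzygies_upto N n g e \<subseteq> syzygies_upto N n g e'"
  using vectors_upto_mono[of e e' N n] by (auto simp: syzygies_upto_def)

lemma syzygies_upto_combine:
  assumes "y \<in> syzygies_upto N n g e" "z \<in> syzygies_upto N n g e"
  shows "(\<lambda>i. of_int k * y i + of_int l * z i) \<in> syzygies_upto N n g e"
proof -
  have "Poly_Mapping.keys (of_int k * y i + of_int l * z i) \<subseteq> monomials_upto N e" if "i < n" for i
  proof
    fix \<alpha> assume "\<alpha> \<in> Poly_Mapping.keys (of_int k * y i + of_int l * z i)"
    then have "\<alpha> \<in> Poly_Mapping.keys (y i) \<or> \<alpha> \<in> Poly_Mapping.keys (z i)"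
      by (auto simp: in_keys_iff lookup_add)
    then show "\<alpha> \<in> monomials_upto N e"
      using assms that by (auto simp: syzygies_upto_def vectors_upto_def)
  qed
  moreover have "row_apply n g (\<lambda>i. of_int k * y i + of_int l * z i) =
      of_int k * row_apply n g y + of_int l * row_apply n g z"
    by (simp add: row_apply_def sum_distrib_left distrib_left sum.distrib mult_ac)
  ultimately show ?thesis using assms by (simp add: syzygies_upto_def vectors_upto_def)
qed

lemma zero_syzygies_upto: "(\<lambda>_. 0) \<in> syzygies_upto N n g e"
  by (simp add: syzygies_upto_def vectors_upto_def row_apply_def)

lemma coords_combine:
  "coords (\<lambda>i. of_int k * y i + of_int l * z i) = (\<lambda>b. k * coords y b + l * coords z b)"
  by (auto simp: coords_def lookup_add)

lemma int_submodule_coords_syzygies: "int_submodule (coords ` syzygies_upto N n g e)"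
  unfolding int_submodule_def
proof (intro conjI ballI allI)
  have "coords (\<lambda>_. 0) = (\<lambda>_. 0)" by (auto simp: coords_def)
  then show "(\<lambda>_. 0) \<in> coords ` syzygies_upto N n g e" using zero_syzygies_upto by (metis imageI)
next
  fix u w k l
  assume "u \<in> coords ` syzygies_upto N n g e" "w \<in> coords ` syzygies_upto N n g e"
  then obtain y z where yz: "y \<in> syzygies_upto N n g e" "z \<in> syzygies_upto N n g e"
    "u = coords y" "w = coords z"
    by blast
  have "(\<lambda>b. k * u b + l * w b) = coords (\<lambda>i. of_int k * y i + of_int l * z i)"
    by (simp add: coords_combine yz(3,4))
  then show "(\<lambda>b. k * u b + l * w b) \<in> coords ` syzygies_upto N n g e"
    using syzygies_upto_combine[OF yz(1,2)] by blast
qed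

text \<open>For a \<open>\<int>\<close>-module \<open>Y\<close>, all sums of products of polynomials of degree at most one with elements
of \<open>Y\<close>: what is known in degree \<open>e + 1\<close> if \<open>Y\<close> is known in degree \<open>e\<close>.\<close>

definition prolongation :: "nat \<Rightarrow> (nat \<Rightarrow> nat int_mpoly) set \<Rightarrow> (nat \<Rightarrow> nat int_mpoly) set" where
  "prolongation N Y = {\<lambda>i. z i + (\<Sum>v<N. mvar v * w v i) | z w. z \<in> Y \<and> (\<forall>v<N. w v \<in> Y)}"

lemma in_prolongation:
  assumes "(\<lambda>_. 0) \<in> Y" "y \<in> Y"
  shows "y \<in> prolongation N Y" and "v < N \<Longrightarrow> (\<lambda>i. mvar v * y i) \<in> prolongation N Y"
proof -
  show "y \<in> prolongation N Y"
    unfolding prolongation_def using assms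
    by (intro CollectI exI[of _ y] exI[of _ "\<lambda>_ _. 0"]) auto
  assume v: "v < N"
  have "(\<Sum>u<N. mvar u * (if u = v then y i else 0)) = mvar v * y i" for i
  proof -
    have "(\<Sum>u<N. mvar u * (if u = v then y i else 0)) = (\<Sum>u<N. if u = v then mvar v * y i else 0)"
      by (rule sum.cong) auto
    then show ?thesis using v by simp
  qed
  then show "(\<lambda>i. mvar v * y i) \<in> prolongation N Y"
    unfolding prolongation_def using assms
    by (intro CollectI exI[of _ "\<lambda>_. 0"] exI[of _ "\<lambda>u. if u = v then y else (\<lambda>_. 0)"])
      (auto simp: if_distrib[of "\<lambda>f. f _"] cong: if_cong)
qed

lemma int_submodule_coords_prolongation:
  assumes zero: "(\<lambda>_. 0) \<in> Y"
    and comb: "\<And>y z k l. y \<in> Y \<Longrightarrow> z \<in> Y \<Longrightarrow> (\<lambda>i. of_int k * y i + of_int l * z i) \<in> Y"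
  shows "int_submodule (coords ` prolongation N Y)"
  unfolding int_submodule_def
proof (intro conjI ballI allI)
  have "coords (\<lambda>_. 0) = (\<lambda>_. 0)" by (auto simp: coords_def)
  then show "(\<lambda>_. 0) \<in> coords ` prolongation N Y" using in_prolongation[OF zero zero] by (metis imageI)
next
  fix u w k l
  assume "u \<in> coords ` prolongation N Y" "w \<in> coords ` prolongation N Y"
  then obtain y1 y2 where y: "y1 \<in> prolongation N Y" "y2 \<in> prolongation N Y" "u = coords y1" "w = coords y2"
    by blast
  obtain z1 w1 where 1: "z1 \<in> Y" "\<forall>v<N. w1 v \<in> Y" "y1 = (\<lambda>i. z1 i + (\<Sum>v<N. mvar v * w1 v i))"
    using y(1) by (auto simp: prolongation_def)
  obtain z2 w2 where 2: "z2 \<in> Y" "\<forall>v<N. w2 v \<in> Y" "y2 = (\<lambda>i. z2 i + (\<Sum>v<N. mvar v * w2 v i))"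
    using y(2) by (auto simp: prolongation_def)
  have "(\<lambda>i. of_int k * y1 i + of_int l * y2 i) =
      (\<lambda>i. (of_int k * z1 i + of_int l * z2 i) +
        (\<Sum>v<N. mvar v * (of_int k * w1 v i + of_int l * w2 v i)))"
    unfolding 1(3) 2(3)
    by (simp add: sum_distrib_left distrib_left sum.distrib algebra_simps)
  then have "(\<lambda>i. of_int k * y1 i + of_int l * y2 i) \<in> prolongation N Y"
    unfolding prolongation_def using 1(1,2) 2(1,2)
    by (intro CollectI exI[of _ "\<lambda>i. of_int k * z1 i + of_int l * z2 i"]
        exI[of _ "\<lambda>v i. of_int k * w1 v i + of_int l * w2 v i"]) (simp add: comb)
  moreover have "(\<lambda>b. k * u b + l * w b) = coords (\<lambda>i. of_int k * y1 i + of_int l * y2 i)"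
    by (simp add: coords_combine y(3,4))
  ultimately show "(\<lambda>b. k * u b + l * w b) \<in> coords ` prolongation N Y" by blast
qed

lemma prolongation_syzygies_upto:
  "prolongation N (syzygies_upto N n g e) \<subseteq> syzygies_upto N n g (Suc e)"
proof
  fix y assume "y \<in> prolongation N (syzygies_upto N n g e)"
  then obtain z w where zw: "z \<in> syzygies_upto N n g e" "\<forall>v<N. w v \<in> syzygies_upto N n g e"
    "y = (\<lambda>i. z i + (\<Sum>v<N. mvar v * w v i))" by (auto simp: prolongation_def)
  have add: "(\<lambda>i. a i + b i) \<in> syzygies_upto N n g (Suc e)"
    if "a \<in> syzygies_upto N n g (Suc e)" "b \<in> syzygies_upto N n g (Suc e)" for a b
    using syzygies_upto_combine[OF that, of 1 1] by simp
  have "k \<le> N \<Longrightarrow> (\<lambda>i. z i + (\<Sum>v<k. mvar v * w v i)) \<in> syzygies_upto N n g (Suc e)" for k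
  proof (induction k)
    case 0
    then show ?case using zw(1) syzygies_upto_mono[of e "Suc e"] by auto
  next
    case (Suc k)
    have "(\<lambda>i. mvar k * w k i) \<in> syzygies_upto N n g (Suc e)"
      using Suc zw by (intro mvar_times_syzygies_upto) auto
    moreover have "(\<lambda>i. z i + (\<Sum>v<k. mvar v * w v i)) \<in> syzygies_upto N n g (Suc e)" using Suc by simp
    ultimately show ?case using add by (fastforce simp: add.assoc)
  qed
  then show "y \<in> syzygies_upto N n g (Suc e)" using zw(3) by simp
qed

text \<open>A degree bound for generators of the syzygies over the integers that depends only on the numbers
of indeterminates and entries and on the degree of the entries. For a row \<open>g\<close> and \<open>p\<close> zero or
prime, put the leading positions of the syzygies modulo \<open>p\<close> and the leading monomials of the
values over the rationals (as an additional entry with index \<open>n\<close>) into one graded set. By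
\<open>card_lead_sets\<close> all these sets have the same Hilbert function, so beyond a common degree \<open>D\<close> all
their elements are multiples of earlier ones. For one \<open>g\<close> and all \<open>p\<close> together, this is the
hypothesis of \<open>submodule_eqI_lead_sets\<close>.\<close>

theorem syzygies_degree_bound:
  "\<exists>D. \<forall>g. (\<forall>i<n. Poly_Mapping.keys (g i) \<subseteq> monomials_upto N d) \<longrightarrow>
     (\<forall>e\<ge>D. syzygies_upto N n g (Suc e) = prolongation N (syzygies_upto N n g e))"
proof -
  define G where "G = {g :: nat \<Rightarrow> nat int_mpoly. \<forall>i<n. Poly_Mapping.keys (g i) \<subseteq> monomials_upto N d}"
  define ls where "ls p g e = lead_set p (coords ` syzygies_upto N n g e)" for p g e
  define li where "li g e = lead_set 0 ((\<lambda>y. Poly_Mapping.lookup (row_apply n g y)) ` vectors_upto N n e)"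
    for g e
  define Z where "Z p g e = ls p g e \<union> Pair n ` li g e" for p g e
  define \<Z> where "\<Z> = {Z p g | p g. zero_or_prime p \<and> g \<in> G}"
  have ls_sub: "ls p g e \<subseteq> positions N n e" for p g e
  proof
    fix b assume "b \<in> ls p g e"
    then obtain y where "y \<in> syzygies_upto N n g e" "\<not> p dvd coords y b"
      by (auto simp: ls_def lead_set_def)
    moreover have "coords y \<in> supported (positions N n e)" if "y \<in> syzygies_upto N n g e" for y
      using that unfolding syzygies_upto_def coords_vectors_upto[symmetric] by blast
    ultimately show "b \<in> positions N n e"
      by (metis (mono_tags, lifting) dvd_0_right mem_Collect_eq supported_def)
  qed
  have li_sub: "li g e \<subseteq> monomials_upto N (e + d)" if "g \<in> G" for g e
  proof
    fix \<gamma> assume "\<gamma> \<in> li g e"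
    then obtain y where y: "y \<in> vectors_upto N n e" "Poly_Mapping.lookup (row_apply n g y) \<gamma> \<noteq> 0"
      by (auto simp: li_def lead_set_def)
    from y(2) obtain i where i: "i < n" "\<gamma> \<in> Poly_Mapping.keys (g i * y i)"
      unfolding row_apply_def lookup_sum
      by (rule sum.not_neutral_contains_not_neutral) (auto simp: in_keys_iff)
    have "Poly_Mapping.keys (g i * y i) \<subseteq> monomials_upto N (e + d)"
      using that y(1) i by (intro keys_times_monomials_upto) (auto simp: G_def vectors_upto_def)
    then show "\<gamma> \<in> monomials_upto N (e + d)" using i by blast
  qed
  have ls_step: "b \<in> ls p g (Suc e)" "v < N \<Longrightarrow> mon_shift v b \<in> ls p g (Suc e)"
    if "b \<in> ls p g e" for p g e b v
  proof -
    have "coords ` syzygies_upto N n g e \<subseteq> coords ` syzygies_upto N n g (Suc e)"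
      using syzygies_upto_mono[of e "Suc e" N n g] by (intro image_mono) simp
    then show "b \<in> ls p g (Suc e)" using that unfolding ls_def lead_set_def by blast
    assume "v < N"
    then show "mon_shift v b \<in> ls p g (Suc e)"
      using that unfolding ls_def
      by (intro lead_set_mon_shift[of "syzygies_upto N n g e"] mvar_times_syzygies_upto)
  qed
  have li_step: "\<gamma> \<in> li g (Suc e)" "v < N \<Longrightarrow> \<gamma> + mon_var v \<in> li g (Suc e)"
    if "\<gamma> \<in> li g e" for g e \<gamma> v
  proof -
    have "vectors_upto N n e \<subseteq> vectors_upto N n (Suc e)" by (rule vectors_upto_mono) simp
    then show "\<gamma> \<in> li g (Suc e)" using that unfolding li_def lead_set_def by blast
    assume v: "v < N"
    show "\<gamma> + mon_var v \<in> li g (Suc e)"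
      unfolding li_def
    proof (rule lead_set_transport[of "\<lambda>\<gamma>. \<gamma> + mon_var v"])
      show "strict_mono (\<lambda>\<gamma> :: monomial. \<gamma> + mon_var v)" by (auto simp: strict_mono_def)
      show "\<gamma> \<in> lead_set 0 ((\<lambda>y. Poly_Mapping.lookup (row_apply n g y)) ` vectors_upto N n e)"
        using that by (simp add: li_def)
    next
      fix u assume "u \<in> (\<lambda>y. Poly_Mapping.lookup (row_apply n g y)) ` vectors_upto N n e"
      then obtain y where y: "y \<in> vectors_upto N n e" "u = Poly_Mapping.lookup (row_apply n g y)" by blast
      then show "\<exists>u'\<in>(\<lambda>y. Poly_Mapping.lookup (row_apply n g y)) ` vectors_upto N n (Suc e).
          (\<forall>b. u' (b + mon_var v) = u b) \<and> (\<forall>b. b \<notin> range (\<lambda>\<gamma>. \<gamma> + mon_var v) \<longrightarrow> u' b = 0)"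
        by (intro bexI[OF _ imageI[OF mvar_times_vectors_upto[OF y(1) v]]])
          (auto simp: row_apply_mvar_times lookup_mvar_times)
    qed
  qed
  have "\<exists>D. \<forall>Z\<in>\<Z>. \<forall>e\<ge>D. Z (Suc e) \<subseteq> shift_rel N `` Z e"
  proof (rule uniform_generation_bound[where B = "\<lambda>e. {..n} \<times> monomials_upto N (e + d)"
        and h = "\<lambda>e. card (positions N n e)"])
    show "finite ({..n} \<times> monomials_upto N (e + d))" for e by simp
  next
    fix \<zeta> e assume "\<zeta> \<in> \<Z>"
    then obtain p g where pg: "\<zeta> = Z p g" "zero_or_prime p" "g \<in> G" by (auto simp: \<Z>_def)
    have sub: "ls p g e \<subseteq> positions N n e" "li g e \<subseteq> monomials_upto N (e + d)"
      using ls_sub li_sub pg(3) by auto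
    have fin: "finite (ls p g e)" "finite (li g e)"
      using finite_subset[OF sub(1)] finite_subset[OF sub(2)] by simp_all
    show "\<zeta> e \<subseteq> {..n} \<times> monomials_upto N (e + d)"
      using sub monomials_upto_mono[of e "e + d" N] by (auto simp: pg(1) Z_def)
    show "shift_rel N `` \<zeta> e \<subseteq> \<zeta> (Suc e)"
      using ls_step[of _ p g e] li_step[of _ g e]
      by (auto simp: pg(1) Z_def shift_rel_def mon_shift_def)
    have "card (\<zeta> e) = card (ls p g e) + card (Pair n ` li g e)"
      unfolding pg(1) Z_def using fin sub by (intro card_Un_disjoint) auto
    also have "card (Pair n ` li g e) = card (li g e)" by (rule card_image) (simp add: inj_on_def)
    also have "card (ls p g e) + card (li g e) = card (positions N n e)"
      unfolding ls_def li_def using pg by (intro card_lead_sets) (auto simp: G_def)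
    finally show "card (\<zeta> e) = card (positions N n e)" .
  next
    fix \<zeta> :: "nat \<Rightarrow> (nat \<times> monomial) set"
    assume "\<And>e. \<zeta> e \<subseteq> {..n} \<times> monomials_upto N (e + d)" "\<And>e. shift_rel N `` \<zeta> e \<subseteq> \<zeta> (Suc e)"
    then show "\<exists>D. \<forall>e\<ge>D. \<zeta> (Suc e) \<subseteq> shift_rel N `` \<zeta> e"
      by (rule shift_closed_finitely_generated)
  qed
  then obtain D where D: "\<And>\<zeta> e. \<zeta> \<in> \<Z> \<Longrightarrow> e \<ge> D \<Longrightarrow> \<zeta> (Suc e) \<subseteq> shift_rel N `` \<zeta> e" by blast
  have "syzygies_upto N n g (Suc e) = prolongation N (syzygies_upto N n g e)"
    if g: "g \<in> G" and e: "D \<le> e" for g e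
  proof -
    let ?S = "syzygies_upto N n g"
    have G: "\<forall>i<n. Poly_Mapping.keys (g i) \<subseteq> monomials_upto N d" using g by (simp add: G_def)
    have "coords ` ?S (Suc e) = coords ` prolongation N (?S e)"
    proof (rule submodule_eqI_lead_sets)
      show "pure_set (coords ` ?S (Suc e))" unfolding coords_syzygies_upto[OF G] by (rule pure_matrix_kernel)
      show "int_submodule (coords ` ?S (Suc e))" by (rule int_submodule_coords_syzygies)
      show "int_submodule (coords ` prolongation N (?S e))"
        by (intro int_submodule_coords_prolongation zero_syzygies_upto syzygies_upto_combine)
      show "coords ` prolongation N (?S e) \<subseteq> coords ` ?S (Suc e)"
        using prolongation_syzygies_upto by (rule image_mono)
      show "finite (positions N n (Suc e))" by simp
      show "u b = 0" if "u \<in> coords ` ?S (Suc e)" "b \<notin> positions N n (Suc e)" for u b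
        using that unfolding coords_syzygies_upto[OF G]
        by (cases b) (auto simp: matrix_kernel_def supported_def)
      fix p assume p: "zero_or_prime p"
      show "lead_set p (coords ` ?S (Suc e)) \<subseteq> lead_set p (coords ` prolongation N (?S e))"
      proof
        fix b assume b: "b \<in> lead_set p (coords ` ?S (Suc e))"
        then have "b \<in> Z p g (Suc e)" by (simp add: Z_def ls_def)
        then have "b \<in> shift_rel N `` Z p g e" using D[of "Z p g" e] p g e by (auto simp: \<Z>_def)
        then obtain a where a: "a \<in> Z p g e" "(a, b) \<in> shift_rel N" by blast
        have "fst b < n" using b ls_sub[of p g "Suc e"] by (auto simp: ls_def)
        then have "fst a < n" using a(2) by (auto simp: shift_rel_def)
        then have a': "a \<in> lead_set p (coords ` ?S e)" using a(1) by (auto simp: Z_def ls_def)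
        consider "b = a" | v where "v < N" "b = mon_shift v a"
          using a(2) by (auto simp: shift_rel_def mon_shift_def)
        then show "b \<in> lead_set p (coords ` prolongation N (?S e))"
        proof cases
          case 1
          have "coords ` ?S e \<subseteq> coords ` prolongation N (?S e)"
            using in_prolongation(1)[OF zero_syzygies_upto] by blast
          then show ?thesis using a' 1 unfolding lead_set_def by blast
        next
          case 2
          show ?thesis unfolding 2(2)
            using a' in_prolongation(2)[OF zero_syzygies_upto _ 2(1)]
            by (intro lead_set_mon_shift[of "?S e"])
        qed
      qed
    qed
    then show ?thesis using inj_coords by (auto simp: set_eq_iff image_iff) 
  qed
  then show ?thesis by (intro exI[of _ D]) (auto simp: G_def)
qed

section \<open>Integer linear systems with parameters\<close>

inductive_set int_span :: "('b \<Rightarrow> int) set \<Rightarrow> ('b \<Rightarrow> int) set" for W where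
  zero: "(\<lambda>_. 0) \<in> int_span W"
| step: "y \<in> int_span W \<Longrightarrow> w \<in> W \<Longrightarrow> (\<lambda>b. y b + k * w b) \<in> int_span W"

lemma int_span_add: "z \<in> int_span W \<Longrightarrow> y \<in> int_span W \<Longrightarrow> (\<lambda>b. y b + z b) \<in> int_span W"
proof (induction rule: int_span.induct)
  case (step z w k)
  from int_span.step[OF step.IH[OF step.prems] step.hyps(2), of k] show ?case by (simp add: add.assoc)
qed simp

lemma int_span_scale: "y \<in> int_span W \<Longrightarrow> (\<lambda>b. k * y b) \<in> int_span W"
proof (induction rule: int_span.induct)
  case zero
  show ?case using int_span.zero by simp
next
  case (step y w l)
  from int_span.step[OF step.IH step.hyps(2), of "k * l"] show ?case by (simp add: algebra_simps)
qed

lemma int_span_base: "w \<in> W \<Longrightarrow> w \<in> int_span W"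
  using int_span.step[OF int_span.zero, of w W 1] by simp

lemma int_span_sum:
  assumes "\<And>j. j \<in> J \<Longrightarrow> u j \<in> int_span W"
  shows "(\<lambda>b. \<Sum>j\<in>J. x j * u j b) \<in> int_span W"
  using assms
proof (induction J rule: infinite_finite_induct)
  case (insert j J)
  have "(\<lambda>b. x j * u j b) \<in> int_span W" "(\<lambda>b. \<Sum>j\<in>J. x j * u j b) \<in> int_span W"
    using insert by (auto intro: int_span_scale)
  from int_span_add[OF this(2,1)] show ?case using insert by simp
qed (simp_all add: int_span.zero)

lemma int_span_imageE:
  assumes "y \<in> int_span (u ` J)" "finite J"
  shows "\<exists>x. y = (\<lambda>b. \<Sum>j\<in>J. x j * u j b)"
  using assms(1)
proof induction
  case zero
  show ?case by (intro exI[of _ "\<lambda>_. 0"]) simp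
next
  case (step y w k)
  then obtain x j where x: "y = (\<lambda>b. \<Sum>j\<in>J. x j * u j b)" and j: "j \<in> J" "w = u j" by blast
  have "(\<lambda>b. y b + k * w b) = (\<lambda>b. \<Sum>i\<in>J. (x i + (if i = j then k else 0)) * u i b)"
  proof
    fix b
    have "(\<Sum>i\<in>J. (if i = j then k else 0) * u i b) = (\<Sum>i\<in>J. if i = j then k * u i b else 0)"
      by (rule sum.cong) auto
    also have "\<dots> = k * w b" using j \<open>finite J\<close> by simp
    finally show "y b + k * w b = (\<Sum>i\<in>J. (x i + (if i = j then k else 0)) * u i b)"
      by (simp add: x distrib_right sum.distrib)
  qed
  then show ?case by (intro exI[of _ "\<lambda>i. x i + (if i = j then k else 0)"])
qed

lemma bezout_family:
  fixes t :: "'j \<Rightarrow> int"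
  assumes "finite J"
  shows "\<exists>g s r. (\<forall>j\<in>J. t j = g * r j) \<and> (\<Sum>j\<in>J. s j * t j) = g"
  using assms
proof (induction J rule: finite_induct)
  case (insert j J)
  then obtain g s r where g: "\<forall>j\<in>J. t j = g * r j" "(\<Sum>j\<in>J. s j * t j) = g" by blast
  obtain k l where kl: "k * g + l * t j = gcd g (t j)" using bezout_int by blast
  obtain g1 t1 where d: "g = gcd g (t j) * g1" "t j = gcd g (t j) * t1" by (metis dvdE gcd_dvd1 gcd_dvd2)
  have "(\<Sum>i\<in>J. (if i = j then l else k * s i) * t i) = k * (\<Sum>i\<in>J. s i * t i)"
    unfolding sum_distrib_left by (rule sum.cong) (use insert.hyps in auto)
  then have "(\<Sum>i\<in>insert j J. (if i = j then l else k * s i) * t i) = gcd g (t j)"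
    using insert.hyps g(2) kl by simp
  moreover have "t i = gcd g (t j) * (if i = j then t1 else g1 * r i)" if "i \<in> insert j J" for i
  proof (cases "i = j")
    case False
    then have "t i = g * r i" using g(1) that by blast
    also have "\<dots> = gcd g (t j) * g1 * r i" using d(1) by (rule arg_cong)
    finally show ?thesis using False by (simp add: mult.assoc)
  qed (use d(2) in simp)
  ultimately show ?case
    by (intro exI[of _ "gcd g (t j)"] exI[of _ "\<lambda>i. if i = j then l else k * s i"]
        exI[of _ "\<lambda>i. if i = j then t1 else g1 * r i"] conjI ballI)
qed auto

text \<open>Generators for the members of the span of \<open>W\<close> that satisfy one further equation \<open>L = 0\<close>. The
pairs give the syzygies of the values \<open>L w\<close> with the common factor removed, \<open>( : )\<close> being
exactly the operation that removes it. The factor \<open>(0 : L w)\<close> is \<open>1\<close> if \<open>L w = 0\<close> and \<open>0\<close>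
otherwise, so that it selects the \<open>w\<close> that are solutions themselves.\<close>

definition colon_refine :: "'b set \<Rightarrow> ('b \<Rightarrow> int) \<Rightarrow> ('b \<Rightarrow> int) set \<Rightarrow> ('b \<Rightarrow> int) set" where
  "colon_refine B a W = (let L = \<lambda>w. \<Sum>b\<in>B. a b * w b in
     {\<lambda>b. int_colon 0 (L w) * w b | w. w \<in> W} \<union>
     {\<lambda>b. int_colon (L v) (L w) * w b - int_colon (L w) (L v) * v b | v w. v \<in> W \<and> w \<in> W})"

lemma int_colon_cross: "int_colon a b * b = int_colon b a * a"
proof (cases "a = 0 \<and> b = 0")
  case False
  define g where "g = gcd a b"
  have g: "g \<noteq> 0" "gcd a b = g" "gcd b a = g" using False by (auto simp: g_def gcd.commute)
  obtain a' b' where ab: "a = g * a'" "b = g * b'" unfolding g_def by (meson dvdE gcd_dvd1 gcd_dvd2)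
  have "int_colon a b = a div g" "int_colon b a = b div g"
    using False by (auto simp: int_colon_def g(2,3))
  moreover have "a div g = a'" "b div g = b'" using g(1) by (simp_all add: ab)
  ultimately show ?thesis using ab by simp
qed simp

lemma int_colon_zero: "int_colon 0 a = (if a = 0 then 1 else 0)"
  by (simp add: int_colon_def)

text \<open>Removing from \<open>a\<close> and \<open>b\<close> any common factor \<open>g\<close>, such as the gcd of a longer list, leaves a
multiple of what remains after removing their own gcd.\<close>

lemma int_colon_divides_cofactors:
  assumes "a = g * r" "b = g * s" "g \<noteq> 0"
  shows "\<exists>m. r = m * int_colon a b \<and> s = m * int_colon b a"
proof (cases "a = 0 \<and> b = 0")
  case True
  then show ?thesis using assms by (intro exI[of _ 0]) auto
next
  case False
  have "g dvd gcd a b" using assms by simp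
  then obtain m where m: "gcd a b = g * m" by blast
  have "a = g * m * int_colon a b" "b = g * m * int_colon b a"
    using False by (auto simp: int_colon_def m[symmetric] gcd.commute)
  then have "g * r = g * (m * int_colon a b)" "g * s = g * (m * int_colon b a)"
    using assms by (simp_all add: mult.assoc)
  then show ?thesis using assms(3) by auto
qed

text \<open>Let \<open>z = \<Sum>w. x w * w\<close> with \<open>\<Sum>w. x w * L w = 0\<close>, let \<open>g = \<Sum>w. s w * L w\<close> be the gcd of the values
and \<open>L w = g * r w\<close>, where \<open>g \<noteq> 0\<close>. From \<open>\<Sum>w. s w * r w = 1\<close> and \<open>\<Sum>w. x w * r w = 0\<close> follows the
Koszul identity \<open>z = \<Sum>w v. x w * s v * (r v * w - r w * v)\<close>, whose terms are multiples of the
generators. The Bezout coefficients \<open>s\<close>, which terms in \<open>( : )\<close> do not provide, occur only in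
the proof that the generators suffice.\<close>

lemma int_span_colon_refine:
  assumes "finite W"
  shows "int_span (colon_refine B a W) = {z \<in> int_span W. (\<Sum>b\<in>B. a b * z b) = 0}"
proof -
  define L where "L w = (\<Sum>b\<in>B. a b * w b)" for w
  let ?R = "colon_refine B a W"
  have R: "?R = {\<lambda>b. int_colon 0 (L w) * w b | w. w \<in> W} \<union>
     {\<lambda>b. int_colon (L v) (L w) * w b - int_colon (L w) (L v) * v b | v w. v \<in> W \<and> w \<in> W}"
    by (simp add: colon_refine_def L_def Let_def)
  have L_comb: "L (\<lambda>b. k * y b + l * z b) = k * L y + l * L z" for k l y z
    by (simp add: L_def sum_distrib_left distrib_left sum.distrib mult_ac)
  have Rw: "y \<in> int_span W \<and> L y = 0" if "y \<in> ?R" for y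
    using that unfolding R
  proof (elim UnE CollectE exE conjE)
    fix w assume w: "y = (\<lambda>b. int_colon 0 (L w) * w b)" "w \<in> W"
    have "L y = int_colon 0 (L w) * L w" using L_comb[of "int_colon 0 (L w)" w 0 w] by (simp add: w(1))
    then have "L y = 0" by (simp add: int_colon_zero)
    moreover have "y \<in> int_span W" unfolding w(1) using w(2) by (intro int_span_scale int_span_base)
    ultimately show ?thesis by blast
  next
    fix v w assume y: "y = (\<lambda>b. int_colon (L v) (L w) * w b - int_colon (L w) (L v) * v b)"
      and vw: "v \<in> W" "w \<in> W"
    have y': "y = (\<lambda>b. int_colon (L v) (L w) * w b + (- int_colon (L w) (L v)) * v b)" by (simp add: y)
    have "L y = 0" unfolding y' L_comb by (simp add: int_colon_cross)
    moreover have "y \<in> int_span W" unfolding y' using vw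
      by (intro int_span_add int_span_scale int_span_base)
    ultimately show ?thesis by blast
  qed
  have "z \<in> int_span W \<and> L z = 0" if "z \<in> int_span ?R" for z
    using that
  proof induction
    case zero
    show ?case by (simp add: int_span.zero L_def)
  next
    case (step y w k)
    then show ?case using Rw[of w] L_comb[of 1 y k w] by (auto intro: int_span_add int_span_scale)
  qed
  moreover have "z \<in> int_span ?R" if z: "z \<in> int_span W" "L z = 0" for z
  proof -
    obtain x where x: "z = (\<lambda>b. \<Sum>w\<in>W. x w * w b)"
      using int_span_imageE[of z id W] z(1) assms by auto
    have "L z = (\<Sum>w\<in>W. x w * L w)"
      unfolding L_def x sum_distrib_left by (subst sum.swap) (simp add: mult_ac)
    then have xL: "(\<Sum>w\<in>W. x w * L w) = 0" using z(2) by simp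
    obtain g s r where g: "\<forall>w\<in>W. L w = g * r w" "(\<Sum>w\<in>W. s w * L w) = g"
      using bezout_family[OF assms, of L] by blast
    show ?thesis
    proof (cases "g = 0")
      case True
      have "w \<in> ?R" if "w \<in> W" for w
      proof -
        have "(\<lambda>b. int_colon 0 (L w) * w b) = w" using g(1) that True by (simp add: int_colon_zero)
        then show ?thesis unfolding R using that by (metis (mono_tags, lifting) UnI1 mem_Collect_eq)
      qed
      then show ?thesis unfolding x by (intro int_span_sum int_span_base)
    next
      case False
      have "g * (\<Sum>w\<in>W. s w * r w) = g * 1"
        unfolding sum_distrib_left using g by (simp add: mult_ac)
      then have sr: "(\<Sum>w\<in>W. s w * r w) = 1" using False by simp
      have "g * (\<Sum>w\<in>W. x w * r w) = 0"
        unfolding sum_distrib_left using g(1) xL by (simp add: mult_ac)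
      then have xr: "(\<Sum>w\<in>W. x w * r w) = 0" using False by simp
      have pair: "(\<lambda>b. r v * w b - r w * v b) \<in> int_span ?R" if vw: "v \<in> W" "w \<in> W" for v w
      proof -
        have "L v = g * r v" "L w = g * r w" using g(1) vw by auto
        from int_colon_divides_cofactors[OF this False]
        obtain m where m: "r v = m * int_colon (L v) (L w)" "r w = m * int_colon (L w) (L v)" by blast
        have "(\<lambda>b. int_colon (L v) (L w) * w b - int_colon (L w) (L v) * v b) \<in> ?R"
          unfolding R using vw by blast
        from int_span_scale[OF int_span_base[OF this], of m] show ?thesis
          by (simp add: m algebra_simps)
      qed
      have "z = (\<lambda>b. \<Sum>w\<in>W. 1 * (\<Sum>v\<in>W. (x w * s v) * (r v * w b - r w * v b)))"
      proof
        fix b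
        have "(\<Sum>w\<in>W. \<Sum>v\<in>W. (x w * s v) * (r v * w b - r w * v b)) =
            (\<Sum>w\<in>W. \<Sum>v\<in>W. (x w * w b) * (s v * r v)) - (\<Sum>w\<in>W. \<Sum>v\<in>W. (x w * r w) * (s v * v b))"
          by (simp add: sum_subtractf[symmetric] algebra_simps)
        also have "\<dots> = (\<Sum>w\<in>W. x w * w b) * (\<Sum>v\<in>W. s v * r v) -
            (\<Sum>w\<in>W. x w * r w) * (\<Sum>v\<in>W. s v * v b)"
          by (simp add: sum_product)
        finally show "z b = (\<Sum>w\<in>W. 1 * (\<Sum>v\<in>W. (x w * s v) * (r v * w b - r w * v b)))"
          by (simp add: sr xr x)
      qed
      also have "\<dots> \<in> int_span ?R" by (intro int_span_sum pair)
      finally show ?thesis .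
    qed
  qed
  ultimately show ?thesis unfolding L_def by blast
qed

text \<open>Terms are handled through the functions of the parameters that they define: closure properties of
this predicate replace the construction of terms.\<close>

definition definable :: "nat \<Rightarrow> ((nat \<Rightarrow> int) \<Rightarrow> int) \<Rightarrow> bool" where
  "definable M h \<longleftrightarrow> (\<exists>t. gvars t \<subseteq> {..<M} \<and> (\<forall>c. int_value c t = h c))"

lemma definable_var: "i < M \<Longrightarrow> definable M (\<lambda>c. c i)"
  unfolding definable_def by (intro exI[of _ "GVar i"]) auto

lemma definable_0: "definable M (\<lambda>_. 0)"
  unfolding definable_def by (intro exI[of _ GZero]) auto

lemma definable_1: "definable M (\<lambda>_. 1)"
  unfolding definable_def by (intro exI[of _ GOne]) auto

lemma definable_binary:
  assumes "definable M h" "definable M k"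
  shows "definable M (\<lambda>c. h c + k c)" "definable M (\<lambda>c. h c - k c)" "definable M (\<lambda>c. h c * k c)"
    "definable M (\<lambda>c. int_colon (h c) (k c))"
proof -
  obtain t u where t: "gvars t \<subseteq> {..<M}" "\<forall>c. int_value c t = h c"
    and u: "gvars u \<subseteq> {..<M}" "\<forall>c. int_value c u = k c" using assms by (auto simp: definable_def)
  show "definable M (\<lambda>c. h c + k c)" "definable M (\<lambda>c. h c - k c)" "definable M (\<lambda>c. h c * k c)"
    "definable M (\<lambda>c. int_colon (h c) (k c))"
    unfolding definable_def using t u
    by (intro exI[of _ "GAdd t u"] exI[of _ "GSub t u"] exI[of _ "GMul t u"] exI[of _ "GColon t u"]; simp)+
qed

lemma definable_sum: "(\<And>j. j \<in> J \<Longrightarrow> definable M (h j)) \<Longrightarrow> definable M (\<lambda>c. \<Sum>j\<in>J. h j c)"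
  by (induction J rule: infinite_finite_induct) (auto intro: definable_0 definable_binary)

lemma definable_const: "definable M (\<lambda>_. k)"
proof -
  have nat: "definable M (\<lambda>_. int m)" for m
    by (induction m) (auto intro: definable_0 definable_1 definable_binary(1))
  show ?thesis
    by (cases k rule: int_cases2) (use nat definable_binary(2)[OF definable_0 nat] in auto)
qed

text \<open>The equations are imposed one after the other. The generators are functions of the parameter, and
as each step is uniform in the parameter, one finite family serves all values.\<close>

lemma definable_kernel_generators:
  fixes a :: "(nat \<Rightarrow> int) \<Rightarrow> 'e \<Rightarrow> 'b \<Rightarrow> int"
  assumes "finite B" "finite E" "\<And>e b. e \<in> E \<Longrightarrow> b \<in> B \<Longrightarrow> definable M (\<lambda>c. a c e b)"
  shows "\<exists>W. finite W \<and> (\<forall>w\<in>W. \<forall>b. definable M (\<lambda>c. w c b)) \<and>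
    (\<forall>c. int_span ((\<lambda>w. w c) ` W) = {z \<in> supported B. \<forall>e\<in>E. (\<Sum>b\<in>B. a c e b * z b) = 0})"
  using assms(2,3)
proof (induction E rule: finite_induct)
  case empty
  define unit where "unit b = (\<lambda>(c :: nat \<Rightarrow> int) x. if x = b then 1 else 0 :: int)" for b :: 'b
  have "int_span ((\<lambda>w. w c) ` unit ` B) = supported B" for c
  proof (rule set_eqI, rule iffI)
    fix z assume "z \<in> int_span ((\<lambda>w. w c) ` unit ` B)"
    then show "z \<in> supported B"
      by induction (auto simp: supported_def unit_def split: if_splits)
  next
    fix z assume z: "z \<in> supported B"
    have "z = (\<lambda>x. \<Sum>b\<in>B. z b * unit b c x)"
    proof
      fix x
      have "(\<Sum>b\<in>B. z b * unit b c x) = (\<Sum>b\<in>B. if b = x then z x else 0)"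
        by (rule sum.cong) (auto simp: unit_def)
      then show "z x = (\<Sum>b\<in>B. z b * unit b c x)" using z \<open>finite B\<close> by (auto simp: supported_def)
    qed
    also have "\<dots> \<in> int_span ((\<lambda>w. w c) ` unit ` B)"
      by (intro int_span_sum int_span_base) auto
    finally show "z \<in> int_span ((\<lambda>w. w c) ` unit ` B)" .
  qed
  moreover have "definable M (\<lambda>c. unit b c x)" for b x by (simp add: unit_def definable_const)
  ultimately show ?case using \<open>finite B\<close> by (intro exI[of _ "unit ` B"]) auto
next
  case (insert e E)
  have "\<exists>W. finite W \<and> (\<forall>w\<in>W. \<forall>b. definable M (\<lambda>c. w c b)) \<and>
      (\<forall>c. int_span ((\<lambda>w. w c) ` W) = {z \<in> supported B. \<forall>e\<in>E. (\<Sum>b\<in>B. a c e b * z b) = 0})"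
    by (rule insert.IH) (rule insert.prems, simp_all)
  then obtain W where Wall: "finite W" "\<forall>w\<in>W. \<forall>b. definable M (\<lambda>c. w c b)"
    "\<forall>c. int_span ((\<lambda>w. w c) ` W) = {z \<in> supported B. \<forall>e\<in>E. (\<Sum>b\<in>B. a c e b * z b) = 0}"
    by (elim exE conjE)
  have W: "finite W" "\<And>w b. w \<in> W \<Longrightarrow> definable M (\<lambda>c. w c b)"
    "\<And>c. int_span ((\<lambda>w. w c) ` W) = {z \<in> supported B. \<forall>e\<in>E. (\<Sum>b\<in>B. a c e b * z b) = 0}"
    using Wall by simp_all
  define L where "L w = (\<lambda>c. \<Sum>b\<in>B. a c e b * w c b)" for w :: "(nat \<Rightarrow> int) \<Rightarrow> 'b \<Rightarrow> int"
  define P where "P w = (\<lambda>c b. int_colon 0 (L w c) * w c b)" for w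
  define Q where "Q = (\<lambda>(v, w) c b. int_colon (L v c) (L w c) * w c b - int_colon (L w c) (L v c) * v c b)"
  let ?W = "P ` W \<union> Q ` (W \<times> W)"
  have L: "definable M (L w)" if "w \<in> W" for w
    unfolding L_def using W(2)[OF that] insert.prems by (intro definable_sum definable_binary(3)) auto
  have "definable M (\<lambda>c. w c b)" if "w \<in> ?W" for w b
    using that L W(2) unfolding P_def Q_def by (auto intro!: definable_binary definable_0)
  moreover have "int_span ((\<lambda>w. w c) ` ?W) =
      {z \<in> supported B. \<forall>e\<in>insert e E. (\<Sum>b\<in>B. a c e b * z b) = 0}" for c
  proof -
    define F where "F v w = (\<lambda>b. int_colon (\<Sum>b\<in>B. a c e b * v b) (\<Sum>b\<in>B. a c e b * w b) * w b -
        int_colon (\<Sum>b\<in>B. a c e b * w b) (\<Sum>b\<in>B. a c e b * v b) * v b)" for v w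
    have "Q (v, w) c = F (v c) (w c)" for v w by (simp add: Q_def F_def L_def)
    then have "(\<lambda>w. w c) ` Q ` (W \<times> W) = (\<lambda>(v, w). F (v c) (w c)) ` (W \<times> W)"
      by (auto simp: image_image intro!: image_cong)
    also have "\<dots> = {F v w | v w. v \<in> (\<lambda>w. w c) ` W \<and> w \<in> (\<lambda>w. w c) ` W}" by auto
    finally have "(\<lambda>w. w c) ` ?W = colon_refine B (a c e) ((\<lambda>w. w c) ` W)"
      unfolding colon_refine_def Let_def image_Un F_def by (auto simp: P_def L_def)
    then show ?thesis
      using int_span_colon_refine[of "(\<lambda>w. w c) ` W" B "a c e"] W(1) by (auto simp: W(3))
  qed
  ultimately show ?case using W(1) by (intro exI[of _ ?W]) auto
qed

section \<open>Specialized polynomials and their coefficients\<close>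

lemma of_int_eq_single: "of_int k = (Poly_Mapping.single 0 k :: 'v int_mpoly)"
  unfolding single_of_int[symmetric] by simp

lemma of_int_times_single:
  "of_int k * Poly_Mapping.single \<alpha> l = (Poly_Mapping.single \<alpha> (k * l) :: 'v int_mpoly)"
  unfolding of_int_eq_single by (simp add: mult_single)

lemma subst_C_power_eq_single:
  assumes "v \<in> CX_vars M N"
  shows "\<exists>\<delta> h. definable M h \<and> Poly_Mapping.keys \<delta> \<subseteq> {..<N} \<and>
    (\<forall>c. subst_C c v ^ k = Poly_Mapping.single \<delta> (h c))"
proof (induction k)
  case 0
  show ?case by (intro exI[of _ 0] exI[of _ "\<lambda>_. 1"]) (simp add: definable_1)
next
  case (Suc k)
  then obtain \<delta> h where h: "definable M h" "Poly_Mapping.keys \<delta> \<subseteq> {..<N}"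
    "\<And>c. subst_C c v ^ k = Poly_Mapping.single \<delta> (h c)" by blast
  show ?case
  proof (cases v)
    case (Inl i)
    then have "i < M" using assms by (auto simp: CX_vars_def)
    moreover have "subst_C c v ^ Suc k = Poly_Mapping.single \<delta> (c i * h c)" for c
      unfolding power_Suc h(3) by (simp add: Inl subst_C_def of_int_times_single)
    ultimately show ?thesis using h(1,2)
      by (intro exI[of _ \<delta>] exI[of _ "\<lambda>c. c i * h c"]) (auto intro: definable_binary definable_var)
  next
    case (Inr j)
    then have "j < N" using assms by (auto simp: CX_vars_def)
    then have "Poly_Mapping.keys (mon_var j + \<delta>) \<subseteq> {..<N}"
      using keys_add[of "mon_var j" \<delta>] h(2) by (auto split: if_splits)
    moreover have "subst_C c v ^ Suc k = Poly_Mapping.single (mon_var j + \<delta>) (h c)" for c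
      unfolding power_Suc h(3) by (simp add: Inr subst_C_def mvar_def mult_single)
    ultimately show ?thesis using h(1) by blast
  qed
qed

lemma mono_eval_subst_C_eq_single:
  assumes "Poly_Mapping.keys m \<subseteq> CX_vars M N"
  shows "\<exists>\<delta> h. definable M h \<and> Poly_Mapping.keys \<delta> \<subseteq> {..<N} \<and>
    (\<forall>c. mono_eval (subst_C c) m = Poly_Mapping.single \<delta> (h c))"
proof -
  have "\<exists>\<delta> h. definable M h \<and> Poly_Mapping.keys \<delta> \<subseteq> {..<N} \<and>
      (\<forall>c. (\<Prod>v\<in>V. subst_C c v ^ e v) = Poly_Mapping.single \<delta> (h c))"
    if "finite V" "V \<subseteq> CX_vars M N" for V and e :: "nat + nat \<Rightarrow> nat"
    using that
  proof (induction V rule: finite_induct)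
    case empty
    show ?case by (intro exI[of _ 0] exI[of _ "\<lambda>_. 1"]) (simp add: definable_1)
  next
    case (insert v V)
    then obtain \<delta> h where h: "definable M h" "Poly_Mapping.keys \<delta> \<subseteq> {..<N}"
      "\<And>c. (\<Prod>v\<in>V. subst_C c v ^ e v) = Poly_Mapping.single \<delta> (h c)" by auto
    obtain \<delta>' h' where h': "definable M h'" "Poly_Mapping.keys \<delta>' \<subseteq> {..<N}"
      "\<And>c. subst_C c v ^ e v = Poly_Mapping.single \<delta>' (h' c)"
      using subst_C_power_eq_single[of v M N "e v"] insert.prems by auto
    have "Poly_Mapping.keys (\<delta>' + \<delta>) \<subseteq> {..<N}" using keys_add[of \<delta>' \<delta>] h(2) h'(2) by auto
    moreover have "(\<Prod>v\<in>insert v V. subst_C c v ^ e v) = Poly_Mapping.single (\<delta>' + \<delta>) (h' c * h c)" for c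
      using insert.hyps by (simp add: h(3) h'(3) mult_single)
    ultimately show ?case using definable_binary(3)[OF h'(1) h(1)]
      by (intro exI[of _ "\<delta>' + \<delta>"] exI[of _ "\<lambda>c. h' c * h c"]) simp
  qed
  then show ?thesis using assms by (simp add: mono_eval_def)
qed

text \<open>The monomials of \<open>p\<close> specialize to monomials in \<open>X\<close> that do not depend on the parameter. This
gives both a parameter-free degree bound and coefficients that are values of terms.\<close>

lemma mpoly_at_eq_sum:
  assumes "p \<in> mpolys (CX_vars M N)"
  obtains S :: "(nat + nat \<Rightarrow>\<^sub>0 nat) set" and \<delta> h where "finite S" "\<And>m. m \<in> S \<Longrightarrow> definable M (h m)"
    "\<And>m. m \<in> S \<Longrightarrow> Poly_Mapping.keys (\<delta> m) \<subseteq> {..<N}"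
    "\<And>c. mpoly_at c p = (\<Sum>m\<in>S. Poly_Mapping.single (\<delta> m) (h m c))"
proof -
  have "\<forall>m\<in>Poly_Mapping.keys p. \<exists>\<delta> h. definable M h \<and> Poly_Mapping.keys \<delta> \<subseteq> {..<N} \<and>
      (\<forall>c. mono_eval (subst_C c) m = Poly_Mapping.single \<delta> (h c))"
    using assms by (intro ballI mono_eval_subst_C_eq_single) (auto simp: mpolys_def mvars_def)
  then obtain \<delta> h where h: "\<And>m. m \<in> Poly_Mapping.keys p \<Longrightarrow> definable M (h m) \<and>
      Poly_Mapping.keys (\<delta> m) \<subseteq> {..<N} \<and> (\<forall>c. mono_eval (subst_C c) m = Poly_Mapping.single (\<delta> m) (h m c))"
    by metis
  have "mpoly_at c p = (\<Sum>m\<in>Poly_Mapping.keys p.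
      Poly_Mapping.single (\<delta> m) (Poly_Mapping.lookup p m * h m c))" for c
    unfolding mpoly_at_def mpoly_eval_def by (intro sum.cong refl) (simp add: h of_int_times_single)
  then show ?thesis using h
    by (intro that[of "Poly_Mapping.keys p" "\<lambda>m c. Poly_Mapping.lookup p m * h m c" \<delta>])
      (auto intro: definable_binary definable_const)
qed

lemma definable_lookup_mpoly_at:
  assumes "p \<in> mpolys (CX_vars M N)"
  shows "definable M (\<lambda>c. Poly_Mapping.lookup (mpoly_at c p) \<alpha>)"
proof -
  obtain S :: "(nat + nat \<Rightarrow>\<^sub>0 nat) set" and \<delta> h
    where *: "finite S" "\<And>m. m \<in> S \<Longrightarrow> definable M (h m)"
    "\<And>m. m \<in> S \<Longrightarrow> Poly_Mapping.keys (\<delta> m) \<subseteq> {..<N}"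
    "\<And>c. mpoly_at c p = (\<Sum>m\<in>S. Poly_Mapping.single (\<delta> m) (h m c))"
    by (rule mpoly_at_eq_sum[OF assms]) (rule that; assumption)
  have "definable M (\<lambda>c. \<Sum>m\<in>S. if \<delta> m = \<alpha> then h m c else 0)"
  proof (rule definable_sum)
    fix m assume "m \<in> S"
    then show "definable M (\<lambda>c. if \<delta> m = \<alpha> then h m c else 0)"
      by (cases "\<delta> m = \<alpha>") (simp_all add: *(2) definable_0)
  qed
  then show ?thesis by (simp add: *(4) lookup_sum lookup_single when_def)
qed

lemma mpoly_at_degree_bound:
  assumes "p \<in> mpolys (CX_vars M N)"
  shows "\<exists>d. \<forall>c. Poly_Mapping.keys (mpoly_at c p) \<subseteq> monomials_upto N d"
proof -
  obtain S :: "(nat + nat \<Rightarrow>\<^sub>0 nat) set" and \<delta> h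
    where *: "finite S" "\<And>m. m \<in> S \<Longrightarrow> definable M (h m)"
    "\<And>m. m \<in> S \<Longrightarrow> Poly_Mapping.keys (\<delta> m) \<subseteq> {..<N}"
    "\<And>c. mpoly_at c p = (\<Sum>m\<in>S. Poly_Mapping.single (\<delta> m) (h m c))"
    by (rule mpoly_at_eq_sum[OF assms]) (rule that; assumption)
  have "Poly_Mapping.keys (mpoly_at c p) \<subseteq> monomials_upto N (\<Sum>m\<in>S. mon_degree N (\<delta> m))" for c
  proof
    fix \<alpha> assume "\<alpha> \<in> Poly_Mapping.keys (mpoly_at c p)"
    then obtain m where m: "m \<in> S" "\<alpha> \<in> Poly_Mapping.keys (Poly_Mapping.single (\<delta> m) (h m c))"
      unfolding *(4) using keys_sum[of "\<lambda>m. Poly_Mapping.single (\<delta> m) (h m c)" S] by blast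
    then have "\<alpha> = \<delta> m" by (simp split: if_splits)
    then show "\<alpha> \<in> monomials_upto N (\<Sum>m\<in>S. mon_degree N (\<delta> m))"
      using *(1,3) m(1) member_le_sum[of m S "\<lambda>m. mon_degree N (\<delta> m)"] by (auto simp: monomials_upto_def)
  qed
  then show ?thesis by blast
qed

lemma definable_macaulay:
  assumes "f i \<in> mpolys (CX_vars M N)"
  shows "definable M (\<lambda>c. macaulay (\<lambda>i. mpoly_at c (f i)) \<gamma> (i, \<alpha>))"
proof (cases "\<exists>\<beta>. \<gamma> = \<alpha> + \<beta>")
  case True
  then obtain \<beta> where "\<gamma> = \<alpha> + \<beta>" by blast
  then show ?thesis
    using definable_lookup_mpoly_at[OF assms] by 
      (simp add: macaulay_def mult.commute[of _ "Poly_Mapping.single _ _"])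
next
  case False
  then have "macaulay (\<lambda>i. mpoly_at c (f i)) \<gamma> (i, \<alpha>) = 0" for c
    unfolding macaulay_def using lookup_single_times_not_divisible[of \<gamma> \<alpha> 1]
    by (simp add: mult.commute[of _ "Poly_Mapping.single _ _"])
  then show ?thesis by (simp add: definable_0)
qed

section \<open>Terms that are polynomial in \<open>X\<close>\<close>

definition ring_expressible :: "nat \<Rightarrow> nat \<Rightarrow> ((nat \<Rightarrow> int) \<Rightarrow> nat int_mpoly) \<Rightarrow> bool" where
  "ring_expressible L N P \<longleftrightarrow> (\<exists>f. ring_term f \<and> gvars f \<subseteq> CX_vars L N \<and>
     (\<forall>c. mpoly_at c (ring_term_poly f) = P c))"

lemma ring_expressible_atoms:
  "ring_expressible L N (\<lambda>_. 0)" "ring_expressible L N (\<lambda>_. 1)"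
  "l < L \<Longrightarrow> ring_expressible L N (\<lambda>c. of_int (c l))"
  "j < N \<Longrightarrow> ring_expressible L N (\<lambda>c. mvar j)"
proof -
  note defs = ring_expressible_def ring_term_poly_def mpoly_at_def CX_vars_def subst_C_def
  show "ring_expressible L N (\<lambda>_. 0)" unfolding defs by (intro exI[of _ GZero]) simp
  show "ring_expressible L N (\<lambda>_. 1)" unfolding defs by (intro exI[of _ GOne]) simp
  show "ring_expressible L N (\<lambda>c. of_int (c l))" if "l < L"
    unfolding defs using that by (intro exI[of _ "GVar (Inl l)"]) auto
  show "ring_expressible L N (\<lambda>c. mvar j)" if "j < N"
    unfolding defs using that by (intro exI[of _ "GVar (Inr j)"]) auto
qed

lemma ring_expressible_binary:
  assumes "ring_expressible L N P" "ring_expressible L N Q"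
  shows "ring_expressible L N (\<lambda>c. P c + Q c)" "ring_expressible L N (\<lambda>c. P c * Q c)"
proof -
  obtain s t where s: "ring_term s" "gvars s \<subseteq> CX_vars L N" "\<forall>c. mpoly_at c (ring_term_poly s) = P c"
    and t: "ring_term t" "gvars t \<subseteq> CX_vars L N" "\<forall>c. mpoly_at c (ring_term_poly t) = Q c"
    using assms by (auto simp: ring_expressible_def)
  show "ring_expressible L N (\<lambda>c. P c + Q c)"
    unfolding ring_expressible_def using s t
    by (intro exI[of _ "GAdd s t"]) (auto simp: ring_term_poly_def mpoly_at_def mpoly_eval_add)
  show "ring_expressible L N (\<lambda>c. P c * Q c)"
    unfolding ring_expressible_def using s t
    by (intro exI[of _ "GMul s t"]) (auto simp: ring_term_poly_def mpoly_at_def mpoly_eval_mult)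
qed

lemma ring_expressible_sum:
  "(\<And>j. j \<in> J \<Longrightarrow> ring_expressible L N (P j)) \<Longrightarrow> ring_expressible L N (\<lambda>c. \<Sum>j\<in>J. P j c)"
  by (induction J rule: infinite_finite_induct)
    (auto intro: ring_expressible_atoms ring_expressible_binary)

lemma nonzero_monomial_cases:
  assumes "\<alpha> \<noteq> 0" "Poly_Mapping.keys \<alpha> \<subseteq> {..<N}"
  shows "\<exists>v \<gamma>. v < N \<and> \<alpha> = \<gamma> + mon_var v \<and> Poly_Mapping.keys \<gamma> \<subseteq> {..<N}"
proof (rule divisible_monomial_cases[of 0 \<alpha> N])
  show "\<exists>v \<gamma>. v < N \<and> \<alpha> = \<gamma> + mon_var v \<and> Poly_Mapping.keys \<gamma> \<subseteq> {..<N}"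
    if "v < N" "\<alpha> = \<gamma> + mon_var v" "Poly_Mapping.keys \<gamma> \<subseteq> {..<N}" for v \<gamma>
    using that by blast
qed (use assms in simp_all)

lemma ring_expressible_monomial:
  "Poly_Mapping.keys \<alpha> \<subseteq> {..<N} \<Longrightarrow> ring_expressible L N (\<lambda>_. Poly_Mapping.single \<alpha> 1)"
proof (induction "mon_degree N \<alpha>" arbitrary: \<alpha>)
  case 0
  have "\<alpha> = 0"
  proof (rule ccontr)
    assume "\<alpha> \<noteq> 0"
    then obtain v \<gamma> where "v < N" "\<alpha> = \<gamma> + mon_var v"
      using nonzero_monomial_cases 0(2) by blast
    then show False using 0(1) by (simp add: mon_degree_add)
  qed
  then show ?case using ring_expressible_atoms(2) by simp
next
  case (Suc d)
  then have "\<alpha> \<noteq> 0" by (auto simp: mon_degree_def)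
  then obtain v \<gamma> where *: "v < N" "\<alpha> = \<gamma> + mon_var v" "Poly_Mapping.keys \<gamma> \<subseteq> {..<N}"
    using nonzero_monomial_cases Suc.prems by blast
  then have "ring_expressible L N (\<lambda>_. Poly_Mapping.single \<gamma> 1)"
    using Suc(1)[of \<gamma>] Suc(2) by (simp add: mon_degree_add)
  from ring_expressible_binary(2)[OF this ring_expressible_atoms(4)[OF *(1)]]
  show ?case by (simp add: *(2) mvar_def mult_single)
qed

lemma ring_term_with_coefficients:
  assumes "\<And>l. l < L \<Longrightarrow> Poly_Mapping.keys (m l) \<subseteq> {..<N}"
  obtains f where "ring_term f" "gvars f \<subseteq> CX_vars L N"
    "\<And>c. mpoly_at c (ring_term_poly f) = (\<Sum>l<L. Poly_Mapping.single (m l) (c l))"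
proof -
  have "ring_expressible L N (\<lambda>c. \<Sum>l<L. of_int (c l) * Poly_Mapping.single (m l) 1)"
    using assms
    by (intro ring_expressible_sum ring_expressible_binary ring_expressible_atoms
        ring_expressible_monomial) auto
  then show ?thesis using that by (auto simp: ring_expressible_def of_int_times_single)
qed

section \<open>Generators of the solution module\<close>

lemma mpolys_iff_bounded: "p \<in> mpolys {..<N} \<longleftrightarrow> (\<exists>e. Poly_Mapping.keys p \<subseteq> monomials_upto N e)"
proof
  assume p: "p \<in> mpolys {..<N}"
  have "\<alpha> \<in> monomials_upto N (\<Sum>\<alpha>\<in>Poly_Mapping.keys p. mon_degree N \<alpha>)" if "\<alpha> \<in> Poly_Mapping.keys p" for \<alpha>
    using p that member_le_sum[of \<alpha> "Poly_Mapping.keys p" "mon_degree N"]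
    by (auto simp: monomials_upto_def mpolys_def mvars_def)
  then show "\<exists>e. Poly_Mapping.keys p \<subseteq> monomials_upto N e" by blast
qed (auto simp: mpolys_def mvars_def monomials_upto_def)

lemma mpolys_closed:
  "0 \<in> mpolys V" "of_int k \<in> mpolys V" "v \<in> V \<Longrightarrow> mvar v \<in> mpolys V"
  "p \<in> mpolys V \<Longrightarrow> q \<in> mpolys V \<Longrightarrow> p + q \<in> mpolys V"
  "p \<in> mpolys V \<Longrightarrow> q \<in> mpolys V \<Longrightarrow> p * q \<in> mpolys V"
proof -
  have iff: "r \<in> mpolys V \<longleftrightarrow> (\<forall>m\<in>Poly_Mapping.keys r. Poly_Mapping.keys m \<subseteq> V)" for r
    by (auto simp: mpolys_def mvars_def)
  show "0 \<in> mpolys V" by (simp add: mpolys_def mvars_def)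
  show "of_int k \<in> mpolys V" by (auto simp: mpolys_def mvars_def simp flip: single_of_int)
  show "v \<in> V \<Longrightarrow> mvar v \<in> mpolys V" by (simp add: mpolys_def mvars_def mvar_def)
  assume pq: "p \<in> mpolys V" "q \<in> mpolys V"
  then show "p + q \<in> mpolys V" using keys_add[of p q] unfolding iff by blast
  have "Poly_Mapping.keys m \<subseteq> V" if "m \<in> Poly_Mapping.keys (p * q)" for m
  proof -
    obtain a b where "m = a + b" "a \<in> Poly_Mapping.keys p" "b \<in> Poly_Mapping.keys q"
      using \<open>m \<in> _\<close> keys_mult[of p q] by blast
    then have "Poly_Mapping.keys a \<subseteq> V" "Poly_Mapping.keys b \<subseteq> V"
      "Poly_Mapping.keys m \<subseteq> Poly_Mapping.keys a \<union> Poly_Mapping.keys b"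
      using pq keys_add[of a b] unfolding iff by auto
    then show ?thesis by blast
  qed
  then show "p * q \<in> mpolys V" unfolding iff by blast
qed

lemma mpolys_sum: "(\<And>j. j \<in> J \<Longrightarrow> P j \<in> mpolys V) \<Longrightarrow> (\<Sum>j\<in>J. P j) \<in> mpolys V"
  by (induction J rule: infinite_finite_induct) (auto intro: mpolys_closed)

lemma syzygies_generated_in_bounded_degree:
  fixes K :: nat
  assumes D: "\<forall>e\<ge>D. syzygies_upto N n g (Suc e) = prolongation N (syzygies_upto N n g e)"
    and gen: "coords ` syzygies_upto N n g D = int_span ((\<lambda>k. coords (Y k)) ` {..<K})"
    and y: "y \<in> syzygies_upto N n g e"
  shows "\<exists>a. (\<forall>k. a k \<in> mpolys {..<N}) \<and> y = (\<lambda>i. \<Sum>k<K. a k * Y k i)"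
proof -
  define G where "G = {y. \<exists>a. (\<forall>k. a k \<in> mpolys {..<N}) \<and> y = (\<lambda>i. \<Sum>k<K. a k * Y k i)}"
  have G0: "(\<lambda>_. 0) \<in> G"
    unfolding G_def by (intro CollectI exI[of _ "\<lambda>_. 0"]) (simp add: mpolys_closed)
  have G_add: "(\<lambda>i. y i + z i) \<in> G" if yz: "y \<in> G" "z \<in> G" for y z
  proof -
    obtain a b where "\<forall>k. a k \<in> mpolys {..<N}" "y = (\<lambda>i. \<Sum>k<K. a k * Y k i)"
      "\<forall>k. b k \<in> mpolys {..<N}" "z = (\<lambda>i. \<Sum>k<K. b k * Y k i)"
      using yz unfolding G_def by (elim CollectE exE conjE)
    then show ?thesis unfolding G_def
      by (intro CollectI exI[of _ "\<lambda>k. a k + b k"]) (simp add: mpolys_closed distrib_right sum.distrib)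
  qed
  have G_mult: "(\<lambda>i. mvar v * y i) \<in> G" if yv: "y \<in> G" "v < N" for y v
  proof -
    obtain a where "\<forall>k. a k \<in> mpolys {..<N}" "y = (\<lambda>i. \<Sum>k<K. a k * Y k i)"
      using yv unfolding G_def by (elim CollectE exE conjE)
    then show ?thesis unfolding G_def using \<open>v < N\<close>
      by (intro CollectI exI[of _ "\<lambda>k. mvar v * a k"]) (simp add: mpolys_closed sum_distrib_left mult.assoc)
  qed
  have base: "syzygies_upto N n g D \<subseteq> G"
  proof
    fix y assume "y \<in> syzygies_upto N n g D"
    then have "coords y \<in> int_span ((\<lambda>k. coords (Y k)) ` {..<K})" using gen by blast
    from int_span_imageE[OF this finite_lessThan] obtain x
      where x: "coords y = (\<lambda>b. \<Sum>k<K. x k * coords (Y k) b)" by (elim exE)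
    also have "\<dots> = coords (\<lambda>i. \<Sum>k<K. of_int (x k) * Y k i)"
      by (auto simp: coords_def lookup_sum)
    finally have "y = (\<lambda>i. \<Sum>k<K. of_int (x k) * Y k i)" by (rule inj_coords)
    then show "y \<in> G" unfolding G_def
      by (intro CollectI exI[of _ "\<lambda>k. of_int (x k)"]) (simp add: mpolys_closed)
  qed
  have "syzygies_upto N n g (D + k) \<subseteq> G" for k
  proof (induction k)
    case 0
    show ?case using base by simp
  next
    case (Suc k)
    show ?case
    proof
      fix y assume "y \<in> syzygies_upto N n g (D + Suc k)"
      then have "y \<in> prolongation N (syzygies_upto N n g (D + k))" using D by simp
      then obtain z w where zw: "z \<in> G" "\<forall>v<N. w v \<in> G" "y = (\<lambda>i. z i + (\<Sum>v<N. mvar v * w v i))"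
        using Suc by (auto simp: prolongation_def)
      have "m \<le> N \<Longrightarrow> (\<lambda>i. \<Sum>v<m. mvar v * w v i) \<in> G" for m
      proof (induction m)
        case (Suc m)
        have "(\<lambda>i. mvar m * w m i) \<in> G" "(\<lambda>i. \<Sum>v<m. mvar v * w v i) \<in> G"
          using Suc zw(2) G_mult by auto
        from G_add[OF this(2,1)] show ?case by simp
      qed (simp add: G0)
      from G_add[OF zw(1) this[of N]] show "y \<in> G" by (simp add: zw(3))
    qed
  qed
  moreover have "syzygies_upto N n g e \<subseteq> syzygies_upto N n g (D + e)" by (rule syzygies_upto_mono) simp
  ultimately show ?thesis using y unfolding G_def by blast
qed

text \<open>If nothing new is needed beyond degree \<open>D\<close>, integer generators of the syzygies up to degree \<open>D\<close>
generate the module of all solutions over the polynomial ring.\<close>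

lemma generated_module_eq_solution_module:
  assumes D: "\<forall>e\<ge>D. syzygies_upto N n g (Suc e) = prolongation N (syzygies_upto N n g e)"
    and gen: "coords ` syzygies_upto N n g D = int_span ((\<lambda>k. coords (Y k)) ` {..<K})"
  shows "generated_module N n K Y = solution_module N n g"
proof (rule set_eqI, rule iffI)
  have Y: "Y k \<in> syzygies_upto N n g D" if "k < K" for k
  proof -
    have "coords (Y k) \<in> coords ` syzygies_upto N n g D"
      unfolding gen using that by (intro int_span_base) auto
    then show ?thesis using inj_coords by auto
  qed
  fix y assume "y \<in> generated_module N n K Y"
  then obtain a where a: "a \<in> {..<K} \<rightarrow> mpolys {..<N}" and y: "y = (\<lambda>i\<in>{..<n}. \<Sum>k<K. a k * Y k i)"
    by (auto simp: generated_module_def)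
  have "Y k i \<in> mpolys {..<N}" if "k < K" "i < n" for k i
    using Y[OF that(1)] that(2) unfolding mpolys_iff_bounded syzygies_upto_def vectors_upto_def by auto
  then have "(\<Sum>k<K. a k * Y k i) \<in> mpolys {..<N}" if "i < n" for i
    using a that by (intro mpolys_sum mpolys_closed) auto
  moreover have "(\<Sum>i<n. g i * y i) = (\<Sum>i<n. \<Sum>k<K. a k * (g i * Y k i))"
    by (rule sum.cong) (auto simp: y sum_distrib_left mult_ac)
  moreover have "\<dots> = (\<Sum>k<K. a k * row_apply n g (Y k))"
    unfolding row_apply_def sum_distrib_left by (rule sum.swap)
  moreover have "\<dots> = 0" using Y by (simp add: syzygies_upto_def)
  ultimately show "y \<in> solution_module N n g" by (auto simp: solution_module_def y)
next
  fix y assume y: "y \<in> solution_module N n g"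
  define z where "z i = (if i < n then y i else 0)" for i
  have "\<forall>i<n. \<exists>e. Poly_Mapping.keys (y i) \<subseteq> monomials_upto N e"
    using y by (auto simp: solution_module_def simp flip: mpolys_iff_bounded)
  then obtain \<epsilon> where \<epsilon>: "\<And>i. i < n \<Longrightarrow> Poly_Mapping.keys (y i) \<subseteq> monomials_upto N (\<epsilon> i)" by metis
  have "Poly_Mapping.keys (y i) \<subseteq> monomials_upto N (\<Sum>i<n. \<epsilon> i)" if "i < n" for i
    using \<epsilon>[OF that] monomials_upto_mono[of "\<epsilon> i" "\<Sum>i<n. \<epsilon> i" N] member_le_sum[of i "{..<n}" \<epsilon>] that
    by auto
  moreover have "row_apply n g z = 0" using y by (simp add: row_apply_def z_def solution_module_def)
  ultimately have "z \<in> syzygies_upto N n g (\<Sum>i<n. \<epsilon> i)"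
    by (auto simp: syzygies_upto_def vectors_upto_def z_def)
  from syzygies_generated_in_bounded_degree[OF D gen this] obtain a
    where a: "\<forall>k. a k \<in> mpolys {..<N}" "z = (\<lambda>i. \<Sum>k<K. a k * Y k i)" by (elim exE conjE)
  have "y = (\<lambda>i\<in>{..<n}. \<Sum>k<K. a k * Y k i)"
  proof
    fix i
    show "y i = (\<lambda>i\<in>{..<n}. \<Sum>k<K. a k * Y k i) i"
    proof (cases "i < n")
      case True
      then show ?thesis using fun_cong[OF a(2), of i] by (simp add: z_def)
    next
      case False
      have "y \<in> {..<n} \<rightarrow>\<^sub>E mpolys {..<N}" using y by (simp add: solution_module_def)
      from PiE_arb[OF this, of i] show ?thesis using False by simp
    qed
  qed
  moreover have "a \<in> {..<K} \<rightarrow> mpolys {..<N}" using a(1) by blast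
  ultimately show "y \<in> generated_module N n K Y"
    unfolding generated_module_def by (intro CollectI exI[of _ a] conjI)
qed

text \<open>With the degrees bounded by \<open>D\<close> for all parameters at once, the coefficients of the solutions
satisfy a homogeneous linear system over the integers whose matrix has definable entries. The
generators of its kernel give the coefficients of the required vectors.\<close>

lemma uniform_generators:
  assumes f: "\<forall>i<n. f i \<in> mpolys (CX_vars M N)"
  shows "\<exists>K y. (\<forall>k<K. \<forall>i<n. polynomial_in_X M N (y k i)) \<and>
    (\<forall>c. generated_module N n K (\<lambda>k i. term_at c (y k i)) = solution_module N n (\<lambda>i. mpoly_at c (f i)))"
proof -
  define g where "g c i = mpoly_at c (f i)" for c i
  have "\<forall>i<n. \<exists>d. \<forall>c. Poly_Mapping.keys (g c i) \<subseteq> monomials_upto N d"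
    using f unfolding g_def by (blast intro: mpoly_at_degree_bound)
  then obtain \<delta> where \<delta>: "\<And>i c. i < n \<Longrightarrow> Poly_Mapping.keys (g c i) \<subseteq> monomials_upto N (\<delta> i)" by metis
  define d where "d = (\<Sum>i<n. \<delta> i)"
  have g_deg: "\<forall>i<n. Poly_Mapping.keys (g c i) \<subseteq> monomials_upto N d" for c
  proof (intro allI impI)
    fix i assume i: "i < n"
    then have "\<delta> i \<le> d" using member_le_sum[of i "{..<n}" \<delta>] by (simp add: d_def)
    then show "Poly_Mapping.keys (g c i) \<subseteq> monomials_upto N d"
      using \<delta>[OF i, of c] monomials_upto_mono by blast
  qed
  from syzygies_degree_bound[of n N d] obtain D
    where all_g: "\<forall>g. (\<forall>i<n. Poly_Mapping.keys (g i) \<subseteq> monomials_upto N d) \<longrightarrow>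
      (\<forall>e\<ge>D. syzygies_upto N n g (Suc e) = prolongation N (syzygies_upto N n g e))" by (elim exE)
  have D: "\<forall>e\<ge>D. syzygies_upto N n (g c) (Suc e) = prolongation N (syzygies_upto N n (g c) e)" for c
    by (rule mp[OF spec[OF all_g, of "g c"] g_deg])
  have "\<exists>W. finite W \<and> (\<forall>w\<in>W. \<forall>b. definable M (\<lambda>c. w c b)) \<and>
    (\<forall>c. int_span ((\<lambda>w. w c) ` W) = {z \<in> supported (positions N n D).
      \<forall>\<gamma>\<in>monomials_upto N (D + d). (\<Sum>b\<in>positions N n D. macaulay (g c) \<gamma> b * z b) = 0})"
  proof (rule definable_kernel_generators)
    fix \<gamma> b assume "b \<in> positions N n D"
    then show "definable M (\<lambda>c. macaulay (g c) \<gamma> b)"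
      using f unfolding g_def by (cases b) (auto intro!: definable_macaulay)
  qed simp_all
  then obtain W where W: "finite W" "\<forall>w\<in>W. \<forall>b. definable M (\<lambda>c. w c b)"
    and span: "\<forall>c. int_span ((\<lambda>w. w c) ` W) = {z \<in> supported (positions N n D).
      \<forall>\<gamma>\<in>monomials_upto N (D + d). (\<Sum>b\<in>positions N n D. macaulay (g c) \<gamma> b * z b) = 0}"
    by (elim exE conjE)
  have span': "int_span ((\<lambda>w. w c) ` W) = coords ` syzygies_upto N n (g c) D" for c
  proof -
    have "{z \<in> supported (positions N n D). \<forall>\<gamma>\<in>monomials_upto N (D + d).
        (\<Sum>b\<in>positions N n D. macaulay (g c) \<gamma> b * z b) = 0} =
      matrix_kernel (positions N n D) (monomials_upto N (D + d)) (macaulay (g c))"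
      unfolding matrix_kernel_def matrix_map_def by (auto simp: fun_eq_iff)
    then show ?thesis using span unfolding coords_syzygies_upto[OF g_deg] by simp
  qed
  obtain en where en: "bij_betw en {..<card W} W"
    using ex_bij_betw_nat_finite[OF W(1)] by (auto simp: atLeast0LessThan)
  define L where "L = card (monomials_upto N D)"
  obtain m where m: "bij_betw m {..<L} (monomials_upto N D)"
    using ex_bij_betw_nat_finite[OF finite_monomials_upto] by (auto simp: atLeast0LessThan L_def)
  have m_keys: "Poly_Mapping.keys (m l) \<subseteq> {..<N}" if "l < L" for l
    using bij_betwE[OF m] that by (auto simp: monomials_upto_def)
  obtain p where p: "ring_term p" "gvars p \<subseteq> CX_vars L N"
    "\<And>c. mpoly_at c (ring_term_poly p) = (\<Sum>l<L. Poly_Mapping.single (m l) (c l))"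
    using ring_term_with_coefficients[of L m N] m_keys by blast
  define t where "t k b = (SOME t. gvars t \<subseteq> {..<M} \<and> (\<forall>c. int_value c t = en k c b))" for k b
  have t: "gvars (t k b) \<subseteq> {..<M} \<and> (\<forall>c. int_value c (t k b) = en k c b)" if "k < card W" for k b
  proof -
    have "en k \<in> W" using bij_betwE[OF en] that by simp
    then have "definable M (\<lambda>c. en k c b)" using W(2) by blast
    then show ?thesis unfolding definable_def t_def by (rule someI_ex)
  qed
  define y where "y k i = plug_in (\<lambda>l. t k (i, m l)) p" for k i
  have "polynomial_in_X M N (y k i)" if "k < card W" for k i
    unfolding polynomial_in_X_def y_def using p(1,2) t[OF that]
    by (intro exI[of _ L] exI[of _ p] exI[of _ "\<lambda>l. t k (i, m l)"] conjI) simp_all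
  moreover have "generated_module N n (card W) (\<lambda>k i. term_at c (y k i)) = solution_module N n (g c)" for c
  proof -
    have "\<exists>Y. Y \<in> syzygies_upto N n (g c) D \<and> coords Y = en k c" if "k < card W" for k
    proof -
      have "en k c \<in> int_span ((\<lambda>w. w c) ` W)" using bij_betwE[OF en] that by (intro int_span_base) auto
      then show ?thesis unfolding span' by auto
    qed
    then obtain Y where Y: "\<And>k. k < card W \<Longrightarrow> Y k \<in> syzygies_upto N n (g c) D"
      "\<And>k. k < card W \<Longrightarrow> coords (Y k) = en k c" by metis
    have "term_at c (y k i) = Y k i" if "k < card W" "i < n" for k i
    proof -
      have "term_at c (y k i) = (\<Sum>l<L. Poly_Mapping.single (m l) (coords (Y k) (i, m l)))"
        unfolding y_def term_at_plug_in[OF p(1)] p(3) using t Y(2) that by simp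
      also have "\<dots> = (\<Sum>\<alpha>\<in>monomials_upto N D. Poly_Mapping.single \<alpha> (coords (Y k) (i, \<alpha>)))"
        by (rule sum.reindex_bij_betw[OF m])
      also have "\<dots> = (\<Sum>\<alpha>\<in>Poly_Mapping.keys (Y k i). Poly_Mapping.single \<alpha> (Poly_Mapping.lookup (Y k i) \<alpha>))"
        using Y(1)[OF that(1)] that(2)
        by (intro sum.mono_neutral_cong_right)
          (auto simp: coords_def syzygies_upto_def vectors_upto_def in_keys_iff)
      also have "\<dots> = Y k i" by (rule int_mpoly_sum_monomials[symmetric])
      finally show ?thesis .
    qed
    then have "generated_module N n (card W) (\<lambda>k i. term_at c (y k i)) = generated_module N n (card W) Y"
      unfolding generated_module_def 
      by (intro Collect_cong ex_cong1 conj_cong arg_cong2[of _ _ _ _ "(=)"] restrict_ext sum.cong) auto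
    also have "\<dots> = solution_module N n (g c)"
    proof (rule generated_module_eq_solution_module[OF D])
      have "(\<lambda>w. w c) ` W = (\<lambda>w. w c) ` en ` {..<card W}"
        using bij_betw_imp_surj_on[OF en] by simp
      also have "\<dots> = (\<lambda>k. coords (Y k)) ` {..<card W}"
        unfolding image_image by (rule image_cong) (simp_all add: Y(2))
      finally show "coords ` syzygies_upto N n (g c) D = int_span ((\<lambda>k. coords (Y k)) ` {..<card W})"
        using span'[of c] by simp
    qed
    finally show ?thesis .
  qed
  ultimately show ?thesis unfolding g_def by blast
qed

text \<open>The generators found above are valid for all parameters, so one trivially true formula suffices.\<close>

theorem theoremD:
  fixes M N n :: nat
    and f :: "nat \<Rightarrow> (nat + nat) int_mpoly"
  assumes "\<forall>i<n. f i \<in> mpolys (CX_vars M N)"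
  shows "\<exists>(\<Lambda> :: nat set) (\<phi> :: nat \<Rightarrow> nat qf_formula) (K :: nat \<Rightarrow> nat)
            (y :: nat \<Rightarrow> nat \<Rightarrow> nat \<Rightarrow> (nat + nat) gcd_term).
    finite \<Lambda> \<and>
    (\<forall>l\<in>\<Lambda>. qvars (\<phi> l) \<subseteq> {..<M}) \<and>
    (\<forall>l\<in>\<Lambda>. \<forall>k<K l. \<forall>i<n. polynomial_in_X M N (y l k i)) \<and>
    (\<forall>c :: nat \<Rightarrow> int.
       (\<exists>l\<in>\<Lambda>. int_sat c (\<phi> l)) \<and>
       (\<forall>l\<in>\<Lambda>. int_sat c (\<phi> l) \<longrightarrow>
          generated_module N n (K l) (\<lambda>k i. term_at c (y l k i)) =
            solution_module N n (\<lambda>i. mpoly_at c (f i))))"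
proof -
  obtain K y where y: "\<forall>k<K. \<forall>i<n. polynomial_in_X M N (y k i)"
    "\<forall>c. generated_module N n K (\<lambda>k i. term_at c (y k i)) = solution_module N n (\<lambda>i. mpoly_at c (f i))"
    using uniform_generators[OF assms] by blast
  show ?thesis
    by (intro exI[of _ "{0}"] exI[of _ "\<lambda>_. QEq GZero GZero"] exI[of _ "\<lambda>_. K"] exI[of _ "\<lambda>_. y"])
      (use y in auto)
qed

end
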